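(* Every labeled tree in $\mathcal{F}$ admits a unique path sequence.
   Context: Graphs are finite and simple. A path covering of a graph $G$ is a set of vertex-disjoint paths of $G$ (a single vertex counts as a path) containing all the vertices of $G$; $P(G)$ is the minimum number of paths in a path covering, and a minimum path covering is one with $P(G)$ paths. The path sequence of a minimum path covering is the nondecreasing sequence of the numbers of vertices of its paths. $G$ admits a unique path sequence if all minimum path coverings of $G$ have the same path sequence. A leaf is a vertex of degree $1$; a vertex is heavy if its degree is greater than $2$, and light otherwise. A vine of a graph is a maximal path one of whose endpoints is a leaf and all of whose vertices are light in the graph; if the graph is not a path, the unique heavy vertex adjacent to an end of the vine is the center of the vine. A generalized star is a tree with exactly one heavy vertex (its center), all of whose vines have the same number of vertices. Labeled pieces. A labeled generalized star is a generalized star in which all non-leaf neighbors of its center are labeled $B$ and all other non-leaf vertices (including the center) are labeled $A$; leaves are unlabeled. In addition, a path with $2k$ edges ($k\ge1$) is regarded as a labeled generalized star with two vines, each with $k$ vertices, whose center is the middle vertex of the path: the non-leaf neighbors of the center are labeled $B$ and the other non-leaf vertices are labeled $A$. A labeled path is a path with at least three vertices in which all non-leaf vertices are labeled $A$ (leaves unlabeled). The family $\mathcal{F}$ consists of all labeled trees obtained from a labeled generalized star with at least three vines, or from a labeled path, by a finite (possibly empty) sequence of the following operations applied to the current labeled tree $T$ (labels are kept, and the added piece is disjoint from $T$): Type-1: take a labeled generalized star $S$ with at least three vines and add an edge $uv$, where $u$ is a vertex of $T$ labeled $A$ and $v$ is the center of $S$. Type-2: take a labeled path $P$ and add an edge $uv$,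 where $u$ is a vertex of $T$ labeled $A$ and $v$ is a non-leaf vertex of $P$. Type-3: take a labeled generalized star $S$ (with two or more vines) and add an edge $uv$, where $v$ is the center of $S$ and $u$ is a vertex of $T$ labeled $B$ such that each vine of $S$ has the same number of vertices as each vine of $S'$, where $S'$ is the labeled generalized star (the initial one or one attached in an earlier operation) that contains $u$. *)

theory Defs
  imports "Graph_Theory.Graph_Theory" "HOL-Library.Sublist" "HOL-Library.Multiset"
begin

(* Finite simple graphs are the symmetric loop-free finite pair digraphs of the locale pair_graph:
   an edge uv is the pair of arcs (u, v), (v, u), so out_degree is the degree. A path of a graph is
   a non-empty list of distinct consecutively adjacent vertices (vpath), i.e. a path together with
   one of its two orientations. *)

definition leaf :: "'a pair_pre_digraph \<Rightarrow> 'a \<Rightarrow> bool" where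
  "leaf G v \<longleftrightarrow> v \<in> pverts G \<and> out_degree G v = 1"

definition heavy :: "'a pair_pre_digraph \<Rightarrow> 'a \<Rightarrow> bool" where
  "heavy G v \<longleftrightarrow> v \<in> pverts G \<and> out_degree G v > 2"

definition light :: "'a pair_pre_digraph \<Rightarrow> 'a \<Rightarrow> bool" where
  "light G v \<longleftrightarrow> v \<in> pverts G \<and> \<not> heavy G v"

(* The constants forest and tree of Digraph_Component do not apply here: they count the closed
   walk u, v, u along a single edge as a cycle. *)
definition undirected_cycle :: "'a pair_pre_digraph \<Rightarrow> 'a list \<Rightarrow> bool" where
  "undirected_cycle G p \<longleftrightarrow> vpath p G \<and> length p \<ge> 3 \<and> (last p, hd p) \<in> parcs G"

definition undirected_tree :: "'a pair_pre_digraph \<Rightarrow> bool" where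
  "undirected_tree G \<longleftrightarrow> pair_graph G \<and> connected G \<and> (\<nexists>p. undirected_cycle G p)"

section \<open>Path coverings\<close>

(* Disjointness excludes that a covering contains a path in both orientations. *)
definition path_covering :: "'a pair_pre_digraph \<Rightarrow> 'a list set \<Rightarrow> bool" where
  "path_covering G C \<longleftrightarrow>
     (\<forall>p\<in>C. vpath p G) \<and>
     (\<forall>p\<in>C. \<forall>q\<in>C. p \<noteq> q \<longrightarrow> set p \<inter> set q = {}) \<and>
     (\<Union>p\<in>C. set p) = pverts G"

definition path_cover_number :: "'a pair_pre_digraph \<Rightarrow> nat" where
  "path_cover_number G = (LEAST n. \<exists>C. path_covering G C \<and> card C = n)"

definition min_path_covering :: "'a pair_pre_digraph \<Rightarrow> 'a list set \<Rightarrow> bool" where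
  "min_path_covering G C \<longleftrightarrow> path_covering G C \<and> card C = path_cover_number G"

definition path_sequence :: "'a list set \<Rightarrow> nat list" where
  "path_sequence C = sorted_list_of_multiset (image_mset length (mset_set C))"

definition unique_path_sequence :: "'a pair_pre_digraph \<Rightarrow> bool" where
  "unique_path_sequence G \<longleftrightarrow>
     (\<forall>C D. min_path_covering G C \<longrightarrow> min_path_covering G D \<longrightarrow> path_sequence C = path_sequence D)"

section \<open>Generalized stars and paths\<close>

definition light_leaf_path :: "'a pair_pre_digraph \<Rightarrow> 'a list \<Rightarrow> bool" where
  "light_leaf_path G p \<longleftrightarrow>
     vpath p G \<and> (leaf G (hd p) \<or> leaf G (last p)) \<and> (\<forall>v\<in>set p. light G v)"

(* The contiguous sublists of a path are its subpaths. As light_leaf_path is invariant under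
   reversal, comparing p with paths traversed in the same direction suffices. *)
definition vine :: "'a pair_pre_digraph \<Rightarrow> 'a list \<Rightarrow> bool" where
  "vine G p \<longleftrightarrow> light_leaf_path G p \<and> (\<forall>q. light_leaf_path G q \<and> sublist p q \<longrightarrow> q = p)"

(* Generalized star with center c, each of whose vines has k vertices. It has one vine for each
   neighbor of its heavy center, hence at least three vines. *)
definition generalized_star :: "'a pair_pre_digraph \<Rightarrow> 'a \<Rightarrow> nat \<Rightarrow> bool" where
  "generalized_star G c k \<longleftrightarrow>
     undirected_tree G \<and> {v. heavy G v} = {c} \<and> (\<forall>p. vine G p \<longrightarrow> length p = k)"

definition path_graph :: "'a list \<Rightarrow> 'a pair_pre_digraph" where
  "path_graph p = \<lparr> pverts = set p, parcs = set (vwalk_arcs p) \<union> (set (vwalk_arcs p))\<inverse> \<rparr>"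

(* A path with 2k edges, regarded as a star with two vines of k vertices each around its middle
   vertex c. *)
definition two_vine_star :: "'a pair_pre_digraph \<Rightarrow> 'a \<Rightarrow> nat \<Rightarrow> bool" where
  "two_vine_star G c k \<longleftrightarrow>
     k \<ge> 1 \<and> (\<exists>p. distinct p \<and> length p = 2 * k + 1 \<and> G = path_graph p \<and> c = p ! k)"

definition path_piece :: "'a pair_pre_digraph \<Rightarrow> bool" where
  "path_piece G \<longleftrightarrow> (\<exists>p. distinct p \<and> length p \<ge> 3 \<and> G = path_graph p)"

section \<open>Labeled trees\<close>

datatype label = Label_A | Label_B

(* None means unlabeled. *)
type_synonym 'a labeling = "'a \<Rightarrow> label option"

definition star_labeling :: "'a pair_pre_digraph \<Rightarrow> 'a \<Rightarrow> 'a labeling" where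
  "star_labeling G c v =
     (if v \<notin> pverts G \<or> leaf G v then None
      else if (c, v) \<in> parcs G then Some Label_B
      else Some Label_A)"

definition path_labeling :: "'a pair_pre_digraph \<Rightarrow> 'a labeling" where
  "path_labeling G v = (if v \<notin> pverts G \<or> leaf G v then None else Some Label_A)"

definition join_by_edge ::
  "'a pair_pre_digraph \<Rightarrow> 'a pair_pre_digraph \<Rightarrow> 'a \<Rightarrow> 'a \<Rightarrow> 'a pair_pre_digraph" where
  "join_by_edge T S u v =
     \<lparr> pverts = pverts T \<union> pverts S, parcs = parcs T \<union> parcs S \<union> {(u, v), (v, u)} \<rparr>"

(* In constructible T L Q, T is the current tree and L its labeling. Q consists of the labeled
   generalized stars used so far, each with the number of vertices of its vines. It is needed because
   type 3 refers to the star that contributed u, which the labeled tree alone does not display. *)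
inductive constructible ::
  "'a pair_pre_digraph \<Rightarrow> 'a labeling \<Rightarrow> ('a pair_pre_digraph \<times> nat) set \<Rightarrow> bool" where
  init_star:
    "generalized_star S c k \<Longrightarrow> constructible S (star_labeling S c) {(S, k)}"
| init_path:
    "path_piece P \<Longrightarrow> constructible P (path_labeling P) {}"
| type1:
    "\<lbrakk> constructible T L Q; generalized_star S v k; pverts T \<inter> pverts S = {};
       u \<in> pverts T; L u = Some Label_A \<rbrakk>
     \<Longrightarrow> constructible (join_by_edge T S u v) (L ++ star_labeling S v) (insert (S, k) Q)"
| type2:
    "\<lbrakk> constructible T L Q; path_piece P; pverts T \<inter> pverts P = {};
       u \<in> pverts T; L u = Some Label_A; v \<in> pverts P; \<not> leaf P v \<rbrakk>
     \<Longrightarrow> constructible (join_by_edge T P u v) (L ++ path_labeling P) Q"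
| type3:
    "\<lbrakk> constructible T L Q; generalized_star S v k \<or> two_vine_star S v k; pverts T \<inter> pverts S = {};
       u \<in> pverts T; L u = Some Label_B; (S', k) \<in> Q; u \<in> pverts S' \<rbrakk>
     \<Longrightarrow> constructible (join_by_edge T S u v) (L ++ star_labeling S v) (insert (S, k) Q)"

definition family_F :: "('a pair_pre_digraph \<times> 'a labeling) set" where
  "family_F = {(T, L). \<exists>Q. constructible T L Q}"

end

theory Submission
  imports Defs
begin

text \<open>The proof is an induction over the construction, with the invariant that all minimum path coverings
  have the same path lengths, that none of their paths ends in a vertex labeled \<open>A\<close>, and that a path
  ending in a vertex labeled \<open>B\<close> is as long as the vines of the star that contributed this vertex and
  contains no other vertex labeled \<open>B\<close>. The new edge \<open>uv\<close> is a bridge, and a path covering of the new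
  piece one of whose paths ends in \<open>v\<close> is not minimum. So a minimum path covering can use the edge only
  if a minimum path covering of the old tree has a path ending in \<open>u\<close>. For \<open>u\<close> labeled \<open>A\<close> there is
  none. For \<open>u\<close> labeled \<open>B\<close> the path ending in \<open>u\<close> can only be exchanged for a vine of the new star, and
  both have the same number of vertices.\<close>

text \<open>A spider with \<open>m\<close> vines of \<open>k\<close> vertices has path cover number
  \<open>m - 1\<close>: a minimum covering joins two whole vines through the center and leaves the
  others alone, which gives one path of \<open>2 * k + 1\<close> vertices and \<open>m - 2\<close>
  of \<open>k\<close>. A path that ends in the center meets at most one vine, so a covering with
  such a path has at least \<open>m\<close> paths; with exactly \<open>m\<close> it consists of one
  path of \<open>k + 1\<close> vertices and \<open>m - 1\<close> vines. At a vertex \<open>u\<close>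
  labeled B, gluing a path of \<open>k\<close> vertices ending in \<open>u\<close> to the one of
  \<open>k + 1\<close> again gives \<open>2 * k + 1\<close>, which is where equal vine lengths
  enter. The glued path has to satisfy the invariant too. One of its ends is the other end of the
  path that ended in \<open>u\<close>. Uniqueness of the B vertex on that path, together with the
  absence of A at ends, makes this end unlabeled. Counting needs the vines as explicit lists, while
  a generalized star is given by acyclicity, degrees and maximal light paths. Hence the detour
  through \<open>spider\<close>, which covers the two-vine stars as well.\<close>

abbreviation adjacent :: "'a pair_pre_digraph \<Rightarrow> 'a \<Rightarrow> 'a \<Rightarrow> bool" where
  "adjacent G x y \<equiv> (x, y) \<in> parcs G"

definition path_lengths :: "'a list set \<Rightarrow> nat multiset" where
  "path_lengths C = image_mset length (mset_set C)"

definition ends :: "'a list \<Rightarrow> 'a set" where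
  "ends p = {hd p, last p}"

lemma ends_rev [simp]: "ends (rev p) = ends p"
  by (auto simp: ends_def hd_rev last_rev)

section \<open>Paths as lists of vertices, symmetric finite graphs\<close>

lemma set_vwalk_arcs_conv_nth:
  "set (vwalk_arcs p) = {(p ! i, p ! Suc i) |i. Suc i < length p}"
proof (induction p rule: vwalk_arcs.induct)
  case (3 x y xs)
  show ?case
  proof (intro set_eqI iffI)
    fix e assume "e \<in> set (vwalk_arcs (x # y # xs))"
    then consider "e = (x, y)" | "e \<in> set (vwalk_arcs (y # xs))" by auto
    then show "e \<in> {((x # y # xs) ! i, (x # y # xs) ! Suc i) |i. Suc i < length (x # y # xs)}"
    proof cases
      case 1 then show ?thesis by (auto intro!: exI[of _ 0])
    next
      case 2
      then obtain i where "e = ((y # xs) ! i, (y # xs) ! Suc i)" "Suc i < length (y # xs)"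
        unfolding 3 by blast
      then show ?thesis by (auto intro!: exI[of _ "Suc i"])
    qed
  next
    fix e assume "e \<in> {((x # y # xs) ! i, (x # y # xs) ! Suc i) |i. Suc i < length (x # y # xs)}"
    then obtain i where i: "e = ((x # y # xs) ! i, (x # y # xs) ! Suc i)"
      "Suc i < length (x # y # xs)" by blast
    show "e \<in> set (vwalk_arcs (x # y # xs))"
    proof (cases i)
      case 0 then show ?thesis using i by simp
    next
      case (Suc j)
      then have "e \<in> set (vwalk_arcs (y # xs))" unfolding 3 using i by auto
      then show ?thesis by simp
    qed
  qed
qed auto

text \<open>Trades arc lists for \<open>successively\<close>, which splits along \<open>@\<close>
  and \<open>#\<close>; all cutting and gluing of paths below relies on this form.\<close>

lemma vpath_iff:
  "vpath p (with_proj G) \<longleftrightarrow>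
     p \<noteq> [] \<and> distinct p \<and> set p \<subseteq> pverts G \<and> successively (adjacent G) p"
  by (auto simp: vpath_def vwalk_def set_vwalk_arcs_conv_nth successively_conv_nth)

lemma parcs_path_graph:
  "(x, y) \<in> parcs (path_graph p) \<longleftrightarrow>
     (\<exists>i. Suc i < length p \<and> (x = p ! i \<and> y = p ! Suc i \<or> y = p ! i \<and> x = p ! Suc i))"
  by (auto simp: path_graph_def set_vwalk_arcs_conv_nth)

lemma pverts_path_graph [simp]: "pverts (path_graph p) = set p"
  by (simp add: path_graph_def)

lemma pair_pseudo_graphI:
  assumes "finite (pverts G)" "parcs G \<subseteq> pverts G \<times> pverts G"
    and "\<And>x y. (x, y) \<in> parcs G \<Longrightarrow> (y, x) \<in> parcs G"
  shows "pair_pseudo_graph G"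
proof
  show "finite (parcs G)" using assms finite_subset by (metis finite_SigmaI)
  show "symmetric (with_proj G)"
    using assms(3) by (auto simp: symmetric_def sym_def)
qed (use assms in auto)

lemma pair_pseudo_graphD:
  assumes "pair_pseudo_graph G"
  shows "finite (pverts G)" "parcs G \<subseteq> pverts G \<times> pverts G"
    "\<And>x y. (x, y) \<in> parcs G \<Longrightarrow> (y, x) \<in> parcs G"
proof -
  interpret pair_pseudo_graph G by fact
  show "finite (pverts G)" "parcs G \<subseteq> pverts G \<times> pverts G"
    "\<And>x y. (x, y) \<in> parcs G \<Longrightarrow> (y, x) \<in> parcs G"
    using in_arcsD1 in_arcsD2 arcs_symmetric by auto
qed

lemma vpath_rev:
  assumes "pair_pseudo_graph G" "vpath p (with_proj G)"
  shows "vpath (rev p) (with_proj G)"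
  using assms by (auto simp: vpath_iff elim!: successively_mono dest: pair_pseudo_graphD(3))

section \<open>Path coverings\<close>

lemma path_coveringD:
  assumes "path_covering G C"
  shows "p \<in> C \<Longrightarrow> vpath p (with_proj G)"
    "p \<in> C \<Longrightarrow> q \<in> C \<Longrightarrow> x \<in> set p \<Longrightarrow> x \<in> set q \<Longrightarrow> p = q"
    "(\<Union>p\<in>C. set p) = pverts G"
  using assms unfolding path_covering_def by blast+

lemma path_covering_paths:
  assumes "path_covering G C" "p \<in> C"
  shows "p \<noteq> []" "distinct p" "set p \<subseteq> pverts G" "successively (adjacent G) p"
  using path_coveringD(1)[OF assms] by (auto simp: vpath_iff)

lemma path_covering_vertexE:
  assumes "path_covering G C" "x \<in> pverts G"
  obtains p where "p \<in> C" "x \<in> set p"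
  using assms unfolding path_covering_def by blast

lemma path_coveringI:
  assumes "\<And>p. p \<in> C \<Longrightarrow> vpath p (with_proj G)"
    "\<And>p q x. p \<in> C \<Longrightarrow> q \<in> C \<Longrightarrow> x \<in> set p \<Longrightarrow> x \<in> set q \<Longrightarrow> p = q"
    "(\<Union>p\<in>C. set p) = pverts G"
  shows "path_covering G C"
  using assms unfolding path_covering_def by blast

lemma finite_path_covering:
  assumes "path_covering G C" "finite (pverts G)"
  shows "finite C"
proof (rule finite_subset)
  show "C \<subseteq> {p. set p \<subseteq> pverts G \<and> distinct p}"
    using path_covering_paths[OF assms(1)] by blast
qed (use assms finite_subset_distinct in auto)

lemma path_cover_number_le: "path_covering G C \<Longrightarrow> path_cover_number G \<le> card C"
  unfolding path_cover_number_def by (rule Least_le) blast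

lemma ex_min_path_covering: "\<exists>C. min_path_covering G C"
proof -
  have "path_covering G ((\<lambda>v. [v]) ` pverts G)"
    by (rule path_coveringI) (auto simp: vpath_iff)
  then have "\<exists>n C. path_covering G C \<and> card C = n" by blast
  from LeastI_ex[OF this] show ?thesis
    unfolding min_path_covering_def path_cover_number_def .
qed

section \<open>Joining two graphs by a bridge\<close>

lemma pverts_join [simp]: "pverts (join_by_edge T S u v) = pverts T \<union> pverts S"
  and parcs_join [simp]: "parcs (join_by_edge T S u v) = parcs T \<union> parcs S \<union> {(u, v), (v, u)}"
  by (simp_all add: join_by_edge_def)

lemma join_by_edge_commute: "join_by_edge T S u v = join_by_edge S T v u"
  by (auto simp: join_by_edge_def)

locale bridge =
  fixes T S :: "'a pair_pre_digraph" and u v :: 'a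
  assumes T: "pair_pseudo_graph T" and S: "pair_pseudo_graph S"
    and disjoint: "pverts T \<inter> pverts S = {}"
    and u: "u \<in> pverts T" and v: "v \<in> pverts S"
begin

abbreviation J :: "'a pair_pre_digraph" where
  "J \<equiv> join_by_edge T S u v"

text \<open>Allows \<open>vpath_crossing\<close>, which treats paths starting in \<open>T\<close>,
  to be reused for paths starting in \<open>S\<close>.\<close>

lemma swap: "bridge S T v u"
  using T S disjoint u v by (intro bridge.intro) auto

lemma pair_pseudo_graph_join: "pair_pseudo_graph J"
  using pair_pseudo_graphD[OF T] pair_pseudo_graphD[OF S] u v
  by (intro pair_pseudo_graphI) auto

lemma vpath_join_T: "vpath p (with_proj T) \<Longrightarrow> vpath p (with_proj J)"
  by (auto simp: vpath_iff elim!: successively_mono)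

lemma vpath_join_S: "vpath p (with_proj S) \<Longrightarrow> vpath p (with_proj J)"
  by (auto simp: vpath_iff elim!: successively_mono)

lemma adjacent_join:
  assumes "adjacent J x y"
  shows "x \<in> pverts T \<Longrightarrow> y \<in> pverts T \<Longrightarrow> adjacent T x y"
    "x \<in> pverts S \<Longrightarrow> y \<in> pverts S \<Longrightarrow> adjacent S x y"
    "x \<in> pverts T \<Longrightarrow> y \<in> pverts S \<Longrightarrow> x = u \<and> y = v"
    "x \<in> pverts S \<Longrightarrow> y \<in> pverts T \<Longrightarrow> x = v \<and> y = u"
  using assms pair_pseudo_graphD(2)[OF T] pair_pseudo_graphD(2)[OF S] disjoint u v by auto

lemma vpath_join_inside:
  assumes "vpath p (with_proj J)"
  shows "set p \<subseteq> pverts T \<Longrightarrow> vpath p (with_proj T)"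
    "set p \<subseteq> pverts S \<Longrightarrow> vpath p (with_proj S)"
proof -
  have p: "p \<noteq> []" "distinct p" "successively (adjacent J) p" using assms by (auto simp: vpath_iff)
  show "vpath p (with_proj T)" if "set p \<subseteq> pverts T"
    using p that successively_mono[OF p(3), of "adjacent T"] adjacent_join(1)
    unfolding vpath_iff by blast
  show "vpath p (with_proj S)" if "set p \<subseteq> pverts S"
    using p that successively_mono[OF p(3), of "adjacent S"] adjacent_join(2)
    unfolding vpath_iff by blast
qed

text \<open>The only arc that leaves \<open>S\<close> enters \<open>u\<close>.\<close>

lemma stays_in_S:
  assumes "successively (adjacent J) p" "set p \<subseteq> pverts J" "p \<noteq> []" "hd p \<in> pverts S" "u \<notin> set p"
  shows "set p \<subseteq> pverts S"
  using assms
proof (induction p)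
  case (Cons x p)
  show ?case
  proof (cases "p = []")
    case True
    then show ?thesis using Cons.prems by simp
  next
    case False
    then have adj: "adjacent J x (hd p)" and suc: "successively (adjacent J) p"
      using Cons.prems(1) by (simp_all add: successively_Cons)
    have x: "x \<in> pverts S" using Cons.prems(4) by simp
    have mem: "hd p \<in> set p" using False by simp
    then have "hd p \<in> pverts T \<or> hd p \<in> pverts S" "hd p \<noteq> u" using Cons.prems(2,5) by auto
    then have "hd p \<in> pverts S" using adjacent_join(4)[OF adj x] by blast
    then have "set p \<subseteq> pverts S" using Cons.IH[OF suc] Cons.prems False by simp
    then show ?thesis using x by simp
  qed
qed simp

text \<open>The path can leave \<open>T\<close> only from \<open>u\<close> to \<open>v\<close>.
  After that \<open>u\<close> is used up, so it cannot come back.\<close>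

lemma vpath_crossing:
  assumes p: "vpath p (with_proj J)" and hd: "hd p \<in> pverts T" and np: "\<not> set p \<subseteq> pverts T"
  obtains a b where "p = a @ b" "vpath a (with_proj T)" "vpath b (with_proj S)"
    "last a = u" "hd b = v"
proof -
  define a where "a = takeWhile (\<lambda>x. x \<in> pverts T) p"
  define b where "b = dropWhile (\<lambda>x. x \<in> pverts T) p"
  have ab: "p = a @ b" by (simp add: a_def b_def)
  have "b \<noteq> []" using np by (auto simp: b_def dropWhile_eq_Nil_conv)
  then have "hd b \<notin> pverts T" using hd_dropWhile unfolding b_def by metis
  moreover have "hd b \<in> pverts J" using p \<open>b \<noteq> []\<close> hd_in_set[of b] by (auto simp: ab vpath_iff simp del: hd_in_set)
  ultimately have hb: "hd b \<in> pverts S" by simp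
  have "a \<noteq> []" using hd p by (cases p) (auto simp: a_def vpath_iff)
  have aT: "set a \<subseteq> pverts T" using set_takeWhileD unfolding a_def by fast
  have "adjacent J (last a) (hd b)"
    using p \<open>a \<noteq> []\<close> \<open>b \<noteq> []\<close> by (auto simp: ab vpath_iff successively_append_iff)
  then have uv: "last a = u" "hd b = v" using adjacent_join(3) hb aT \<open>a \<noteq> []\<close> by (meson last_in_set subsetD)+
  have pa: "vpath a (with_proj J)" and pb: "vpath b (with_proj J)"
    using p \<open>a \<noteq> []\<close> \<open>b \<noteq> []\<close> by (auto simp: ab vpath_iff successively_append_iff)
  have "u \<in> set a" using uv \<open>a \<noteq> []\<close> last_in_set by metis
  then have "u \<notin> set b" using p by (auto simp: ab vpath_iff)
  then have "set b \<subseteq> pverts S" using stays_in_S[of b] pb hb by (auto simp: vpath_iff)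
  then show ?thesis
    using that[OF ab] vpath_join_inside(1)[OF pa aT] vpath_join_inside(2)[OF pb] uv by simp
qed

text \<open>A path carries a direction and may cross the bridge either way. The alternative
  \<open>rev (a @ b)\<close> allows both crossings to be described from \<open>T\<close> to
  \<open>S\<close>, with \<open>u\<close> at the end of \<open>a\<close> and \<open>v\<close> at the
  start of \<open>b\<close>.\<close>

lemma vpath_join_cases:
  assumes p: "vpath p (with_proj J)"
  obtains "set p \<subseteq> pverts T" | "set p \<subseteq> pverts S"
  | a b where "p = a @ b \<or> p = rev (a @ b)" "vpath a (with_proj T)" "vpath b (with_proj S)"
    "last a = u" "hd b = v"
proof -
  have "p \<noteq> []" "set p \<subseteq> pverts T \<union> pverts S" using p by (simp_all add: vpath_iff)
  then have "hd p \<in> pverts T \<union> pverts S" using hd_in_set by blast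
  then consider "set p \<subseteq> pverts T" | "set p \<subseteq> pverts S"
    | "hd p \<in> pverts T" "\<not> set p \<subseteq> pverts T" | "hd p \<in> pverts S" "\<not> set p \<subseteq> pverts S"
    by blast
  then show ?thesis
  proof cases
    case 1
    then show ?thesis by (rule that(1))
  next
    case 2
    then show ?thesis by (rule that(2))
  next
    case 3
    from p 3 obtain a b where "p = a @ b" "vpath a (with_proj T)" "vpath b (with_proj S)"
      "last a = u" "hd b = v" by (rule vpath_crossing)
    then show ?thesis by (intro that(3)) simp_all
  next
    case 4
    have "vpath p (with_proj (join_by_edge S T v u))"
      using p join_by_edge_commute[of T S u v] by simp
    then obtain b a where ab: "p = b @ a" "vpath b (with_proj S)" "vpath a (with_proj T)"
      "last b = v" "hd a = u"
      using 4 by (rule bridge.vpath_crossing[OF swap])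
    from ab(2,3) have "a \<noteq> []" "b \<noteq> []" by (simp_all add: vpath_iff)
    then show ?thesis
      using that(3)[of "rev a" "rev b"] vpath_rev[OF T ab(3)] vpath_rev[OF S ab(2)] ab
      by (simp add: hd_rev last_rev)
  qed
qed

lemma path_covering_Un:
  assumes "path_covering T CT" "path_covering S CS"
  shows "path_covering J (CT \<union> CS)" "card (CT \<union> CS) = card CT + card CS" "CT \<inter> CS = {}"
proof -
  show "path_covering J (CT \<union> CS)"
  proof (rule path_coveringI)
    fix p q x assume "p \<in> CT \<union> CS" "q \<in> CT \<union> CS" "x \<in> set p" "x \<in> set q"
    moreover have "\<not> (p \<in> CT \<and> q \<in> CS)" if "x \<in> set p" "x \<in> set q" for p q
      using that path_covering_paths(3)[OF assms(1)] path_covering_paths(3)[OF assms(2)] disjoint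
      by blast
    ultimately show "p = q"
      using path_coveringD(2)[OF assms(1), of p q x] path_coveringD(2)[OF assms(2), of p q x] by blast
  next
    show "(\<Union>p\<in>CT \<union> CS. set p) = pverts J"
      using path_coveringD(3)[OF assms(1)] path_coveringD(3)[OF assms(2)] by auto
  next
    fix p assume "p \<in> CT \<union> CS"
    then show "vpath p (with_proj J)"
      using vpath_join_T vpath_join_S path_coveringD(1)[OF assms(1)] path_coveringD(1)[OF assms(2)]
      by (elim UnE) simp_all
  qed
  show "CT \<inter> CS = {}"
  proof (rule ccontr)
    assume "CT \<inter> CS \<noteq> {}"
    then obtain p where "p \<in> CT" "p \<in> CS" by blast
    then show False
      using path_covering_paths(1,3)[OF assms(1)] path_covering_paths(3)[OF assms(2)] disjoint
      by (metis Int_subset_iff set_empty subset_empty)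
  qed
  then show "card (CT \<union> CS) = card CT + card CS"
    using finite_path_covering[OF assms(1)] finite_path_covering[OF assms(2)]
      pair_pseudo_graphD(1)[OF T] pair_pseudo_graphD(1)[OF S]
    by (simp add: card_Un_disjoint)
qed

text \<open>A path that uses the bridge contains \<open>u\<close>, and only one path of the covering
  does. Cutting it at the bridge leaves a covering on each side. That \<open>p\<close> is not among
  the remaining paths is recorded for the later counts of paths and lengths.\<close>

lemma path_covering_join_cases:
  assumes C: "path_covering J C"
  obtains CT CS where "path_covering T CT" "path_covering S CS" "C = CT \<union> CS"
  | CT CS a b p where "path_covering T CT" "path_covering S CS" "a \<in> CT" "b \<in> CS"
    "last a = u" "hd b = v" "p = a @ b \<or> p = rev (a @ b)" "p \<notin> (CT - {a}) \<union> (CS - {b})"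
    "C = insert p ((CT - {a}) \<union> (CS - {b}))"
proof (cases "\<forall>p\<in>C. set p \<subseteq> pverts T \<or> set p \<subseteq> pverts S")
  case True
  define CT CS where "CT = {p \<in> C. set p \<subseteq> pverts T}" and "CS = {p \<in> C. set p \<subseteq> pverts S}"
  have cov: "\<exists>p\<in>C. x \<in> set p" if "x \<in> pverts T \<union> pverts S" for x
    using path_covering_vertexE[OF C, of x] that by (metis pverts_join)
  have "path_covering T CT"
  proof (rule path_coveringI)
    fix p assume "p \<in> CT"
    then show "vpath p (with_proj T)"
      using path_coveringD(1)[OF C] vpath_join_inside(1) by (simp add: CT_def)
  next
    fix p q x assume "p \<in> CT" "q \<in> CT" "x \<in> set p" "x \<in> set q"
    then show "p = q" using path_coveringD(2)[OF C, of p q x] by (simp add: CT_def)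
  next
    show "(\<Union>p\<in>CT. set p) = pverts T"
      using cov True disjoint unfolding CT_def by fast
  qed
  moreover have "path_covering S CS"
  proof (rule path_coveringI)
    fix p assume "p \<in> CS"
    then show "vpath p (with_proj S)"
      using path_coveringD(1)[OF C] vpath_join_inside(2) by (simp add: CS_def)
  next
    fix p q x assume "p \<in> CS" "q \<in> CS" "x \<in> set p" "x \<in> set q"
    then show "p = q" using path_coveringD(2)[OF C, of p q x] by (simp add: CS_def)
  next
    show "(\<Union>p\<in>CS. set p) = pverts S"
      using cov True disjoint unfolding CS_def by fast
  qed
  moreover have "C = CT \<union> CS" using True by (auto simp: CT_def CS_def)
  ultimately show ?thesis using that(1) by blast
next
  case False
  then obtain p where p: "p \<in> C" "\<not> set p \<subseteq> pverts T" "\<not> set p \<subseteq> pverts S" by blast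
  from vpath_join_cases[OF path_coveringD(1)[OF C p(1)]] p
  obtain a b where ab: "p = a @ b \<or> p = rev (a @ b)" "vpath a (with_proj T)"
    "vpath b (with_proj S)" "last a = u" "hd b = v" by metis
  have sp: "set p = set a \<union> set b" using ab(1) by auto
  have sab: "set a \<subseteq> pverts T" "set b \<subseteq> pverts S" "a \<noteq> []" "b \<noteq> []" using ab by (auto simp: vpath_iff)
  have "u \<in> set p" using ab(4) sab sp by auto
  have other: "set q \<subseteq> pverts T \<or> set q \<subseteq> pverts S" and dis: "set q \<inter> set p = {}"
    if q: "q \<in> C" "q \<noteq> p" for q
  proof -
    show "set q \<inter> set p = {}" using path_coveringD(2)[OF C q(1) p(1)] q(2) by blast
    with \<open>u \<in> set p\<close> have "u \<notin> set q" by blast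
    then show "set q \<subseteq> pverts T \<or> set q \<subseteq> pverts S"
      using vpath_join_cases[OF path_coveringD(1)[OF C q(1)]]
      by (metis Un_iff last_in_set set_append set_rev vpath_iff)
  qed
  define RT RS where "RT = {q \<in> C. q \<noteq> p \<and> set q \<subseteq> pverts T}"
    and "RS = {q \<in> C. q \<noteq> p \<and> set q \<subseteq> pverts S}"
  have CR: "C = insert p (RT \<union> RS)" using p(1) other unfolding RT_def RS_def by blast
  have cov: "x \<in> set a \<or> x \<in> set b \<or> (\<exists>q\<in>RT. x \<in> set q) \<or> (\<exists>q\<in>RS. x \<in> set q)"
    if "x \<in> pverts T \<union> pverts S" for x
  proof -
    from that have "x \<in> pverts J" by simp
    then obtain q where "q \<in> C" "x \<in> set q" by (rule path_covering_vertexE[OF C])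
    then have "q = p \<or> q \<in> RT \<or> q \<in> RS" using CR by blast
    then show ?thesis using \<open>x \<in> set q\<close> sp by (elim disjE) auto
  qed
  have RT: "set q \<subseteq> pverts T" if "q \<in> RT" for q using that by (simp add: RT_def)
  have RS: "set q \<subseteq> pverts S" if "q \<in> RS" for q using that by (simp add: RS_def)
  have "path_covering T (insert a RT)"
  proof (rule path_coveringI)
    show "(\<Union>q\<in>insert a RT. set q) = pverts T"
    proof
      show "pverts T \<subseteq> (\<Union>q\<in>insert a RT. set q)"
      proof
        fix x assume "x \<in> pverts T"
        then show "x \<in> (\<Union>q\<in>insert a RT. set q)"
          using cov[of x] disjoint sab(2) RS[THEN subsetD, of _ x] by auto
      qed
    qed (use sab RT in auto)
  next
    fix q r x assume "q \<in> insert a RT" "r \<in> insert a RT" "x \<in> set q" "x \<in> set r"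
    then show "q = r"
      using dis[of q] dis[of r] path_coveringD(2)[OF C, of q r x] unfolding sp RT_def by blast
  next
    fix q assume "q \<in> insert a RT"
    then show "vpath q (with_proj T)"
      using ab(2) path_coveringD(1)[OF C, of q] vpath_join_inside(1)[of q] unfolding RT_def by blast
  qed
  moreover have "path_covering S (insert b RS)"
  proof (rule path_coveringI)
    show "(\<Union>q\<in>insert b RS. set q) = pverts S"
    proof
      show "pverts S \<subseteq> (\<Union>q\<in>insert b RS. set q)"
      proof
        fix x assume "x \<in> pverts S"
        then show "x \<in> (\<Union>q\<in>insert b RS. set q)"
          using cov[of x] disjoint sab(1) RT[THEN subsetD, of _ x] by auto
      qed
    qed (use sab RS in auto)
  next
    fix q r x assume "q \<in> insert b RS" "r \<in> insert b RS" "x \<in> set q" "x \<in> set r"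
    then show "q = r"
      using dis[of q] dis[of r] path_coveringD(2)[OF C, of q r x] unfolding sp RS_def by blast
  next
    fix q assume "q \<in> insert b RS"
    then show "vpath q (with_proj S)"
      using ab(3) path_coveringD(1)[OF C, of q] vpath_join_inside(2)[of q] unfolding RS_def by blast
  qed
  moreover have "a \<notin> RT" "b \<notin> RS"
    using dis[of a] dis[of b] sab(3,4) sp by (auto simp: RT_def RS_def Int_Un_distrib)
  then have "insert a RT - {a} = RT" "insert b RS - {b} = RS" by auto
  moreover have "p \<notin> RT \<union> RS" by (auto simp: RT_def RS_def)
  ultimately show ?thesis
    using CR by (intro that(2)[of "insert a RT" "insert b RS" a b p] ab(1,4,5)) simp_all
qed

text \<open>A covering using the bridge saves one path, but ending a path at \<open>v\<close> already costs one in
  \<open>S\<close>. Hence a minimum covering uses the bridge only if it restricts to a minimum covering of \<open>T\<close>.\<close>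

lemma min_path_covering_join:
  assumes v_cost: "\<And>CS p. path_covering S CS \<Longrightarrow> p \<in> CS \<Longrightarrow> v \<in> ends p \<Longrightarrow>
      path_cover_number S < card CS"
    and C: "min_path_covering J C"
  obtains CT CS where "min_path_covering T CT" "min_path_covering S CS" "C = CT \<union> CS" "CT \<inter> CS = {}"
  | CT CS a b p where "min_path_covering T CT" "path_covering S CS"
    "card CS = Suc (path_cover_number S)" "a \<in> CT" "b \<in> CS"
    "last a = u" "hd b = v" "p = a @ b \<or> p = rev (a @ b)" "p \<notin> (CT - {a}) \<union> (CS - {b})"
    "C = insert p ((CT - {a}) \<union> (CS - {b}))" "CT \<inter> CS = {}"
proof -
  obtain DT DS where D: "min_path_covering T DT" "min_path_covering S DS"
    using ex_min_path_covering by metis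
  \<comment> \<open>The union of minimum coverings of the two sides is a covering that does not use
    the bridge.\<close>
  have le: "card C \<le> path_cover_number T + path_cover_number S"
    using path_covering_Un[of DT DS] D C path_cover_number_le
    unfolding min_path_covering_def by metis
  from C have cov: "path_covering J C" by (simp add: min_path_covering_def)
  from path_covering_join_cases[OF cov] show thesis
  proof cases
    case (1 CT CS)
    then have "card C = card CT + card CS" "path_cover_number T \<le> card CT"
      "path_cover_number S \<le> card CS"
      using path_covering_Un(2)[OF 1(1,2)] path_cover_number_le by simp_all
    then show thesis
      using le path_covering_Un(3)[OF 1(1,2)]
      by (intro that(1)[of CT CS]) (simp_all add: min_path_covering_def 1)
  next
    case (2 CT CS a b p)
    have fin: "finite CT" "finite CS"
      using finite_path_covering[OF 2(1)] finite_path_covering[OF 2(2)]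
        pair_pseudo_graphD(1)[OF T] pair_pseudo_graphD(1)[OF S] by simp_all
    have disj: "CT \<inter> CS = {}" using path_covering_Un(3) 2(1,2) by simp
    have "card CT > 0" "card CS > 0" using fin 2(3,4) by (auto simp: card_gt_0_iff)
    moreover have "card C = Suc (card (CT - {a}) + card (CS - {b}))"
    proof -
      have "(CT - {a}) \<inter> (CS - {b}) = {}" using disj by blast
      then show ?thesis unfolding 2(9) using 2(8) fin by (simp add: card_Un_disjoint)
    qed
    \<comment> \<open>The path \<open>p\<close> counts once in \<open>C\<close>, but its halves
      count once each in \<open>CT\<close> and \<open>CS\<close>. With \<open>le\<close> and the
      extra path in \<open>CS\<close>, all bounds become equalities.\<close>
    ultimately have "Suc (card C) = card CT + card CS" using 2(3,4) fin by simp
    moreover have "path_cover_number T \<le> card CT" "path_cover_number S < card CS"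
      using path_cover_number_le[OF 2(1)] v_cost[OF 2(2,4)] 2(6) by (simp_all add: ends_def)
    ultimately show thesis
      using le by (intro that(2)[OF _ 2(2) _ 2(3-9) disj]) (simp_all add: min_path_covering_def 2(1))
  qed
qed

end

section \<open>Path graphs and spiders\<close>

lemma adjacent_path_graph_nth:
  assumes "distinct q" "i < length q" "adjacent (path_graph q) (q ! i) y"
  shows "Suc i < length q \<and> y = q ! Suc i \<or> 0 < i \<and> y = q ! (i - 1)"
proof -
  from assms(3) obtain j where j: "Suc j < length q"
    "q ! i = q ! j \<and> y = q ! Suc j \<or> y = q ! j \<and> q ! i = q ! Suc j"
    by (auto simp: parcs_path_graph)
  then have "i = j \<and> y = q ! Suc j \<or> y = q ! j \<and> i = Suc j"
    using nth_eq_iff_index_eq[OF assms(1)] assms(2) by (metis Suc_lessD)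
  then show ?thesis using j(1) by auto
qed

lemma pair_pseudo_graph_path_graph: "pair_pseudo_graph (path_graph p)"
proof (rule pair_pseudo_graphI)
  show "parcs (path_graph p) \<subseteq> pverts (path_graph p) \<times> pverts (path_graph p)"
  proof
    fix e assume "e \<in> parcs (path_graph p)"
    then show "e \<in> pverts (path_graph p) \<times> pverts (path_graph p)"
      by (cases e) (auto simp: parcs_path_graph)
  qed
qed (auto simp: parcs_path_graph)

lemma vpath_path_graph: "distinct p \<Longrightarrow> p \<noteq> [] \<Longrightarrow> vpath p (with_proj (path_graph p))"
  unfolding vpath_iff successively_conv_nth parcs_path_graph pverts_path_graph by blast

text \<open>From \<open>q ! n\<close> the path can only go on to \<open>q ! Suc n\<close> or back to
  \<open>q ! (n - 1)\<close>, and the latter has already been visited.\<close>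

lemma path_graph_prefix:
  assumes "distinct q" "distinct a" "successively (adjacent (path_graph q)) a"
    and "a \<noteq> []" "q \<noteq> []" "hd a = hd q"
  shows "prefix a q"
  using assms(2-4,6)
proof (induction a rule: rev_induct)
  case (snoc z a)
  show ?case
  proof (cases "a = []")
    case True
    then show ?thesis using snoc.prems assms(5) by (cases q) simp_all
  next
    case False
    then have pre: "prefix a q"
      using snoc by (simp add: successively_append_iff)
    define n where "n = length a - 1"
    have n: "length a = Suc n" using False by (simp add: n_def)
    have len: "Suc n \<le> length q" using prefix_length_le[OF pre] n by simp
    have a_nth: "a ! i = q ! i" if "i < length a" for i
      using pre that by (auto elim!: prefixE simp: nth_append)
    have la: "last a = q ! n" using False a_nth[of n] n by (simp add: last_conv_nth)
    have "adjacent (path_graph q) (q ! n) z"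
      using snoc.prems(2) False la by (simp add: successively_append_iff)
    from adjacent_path_graph_nth[OF assms(1) _ this] len
    consider "Suc n < length q" "z = q ! Suc n" | "0 < n" "z = q ! (n - 1)" by auto
    then show ?thesis
    proof cases
      case 1
      obtain zs where zs: "q = a @ zs" using pre by (auto elim: prefixE)
      then have "zs \<noteq> []" "hd zs = z" using 1 n by (auto simp: nth_append hd_conv_nth)
      then have "q = (a @ [z]) @ tl zs" using zs by (cases zs) simp_all
      then show ?thesis by (rule prefixI)
    next
      case 2
      then have "z = a ! (n - 1)" using a_nth[of "n - 1"] n by simp
      then have "z \<in> set a" using n by simp
      then show ?thesis using snoc.prems(1) by simp
    qed
  qed
qed simp

text \<open>Cut \<open>p\<close> at the first vertex of \<open>q\<close>. Both parts, read away from
  the cut, are prefixes of \<open>q\<close>. If both went on, both would contain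
  \<open>q ! 1\<close>, against distinctness; so the cut is at an end of \<open>p\<close>, and
  \<open>p\<close> or \<open>rev p\<close> is a prefix of full length.\<close>

lemma vpath_path_graph_spanning:
  assumes q: "distinct q" and p: "vpath p (with_proj (path_graph q))" and sp: "set p = set q"
  shows "p = q \<or> p = rev q"
proof -
  have p': "distinct p" "successively (adjacent (path_graph q)) p" "p \<noteq> []"
    using p by (simp_all add: vpath_iff)
  have revp: "successively (adjacent (path_graph q)) (rev p)"
    using vpath_rev[OF pair_pseudo_graph_path_graph p] by (simp only: vpath_iff)
  have "q \<noteq> []" using sp p'(3) by auto
  then have "hd q \<in> set p" using sp by simp
  then obtain xs ys where xy: "p = xs @ hd q # ys" by (meson split_list)
  have pre1: "prefix (hd q # ys) q"
    using p' \<open>q \<noteq> []\<close> q unfolding xy by (intro path_graph_prefix) (simp_all add: successively_append_iff)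
  have pre2: "prefix (hd q # rev xs) q"
    using p' \<open>q \<noteq> []\<close> q revp unfolding xy
    by (intro path_graph_prefix) (simp_all add: successively_append_iff del: successively_rev)
  have len: "length p = length q" using distinct_card p'(1) q sp by metis
  show ?thesis
  proof (cases "xs = []")
    case True
    then have "prefix p q" using pre1 xy by simp
    then show ?thesis using len by (auto elim: prefixE)
  next
    case xs: False
    show ?thesis
    proof (cases "ys = []")
      case True
      then have "prefix (rev p) q" using pre2 xy by simp
      then have "rev p = q" using len by (auto elim: prefixE)
      then show ?thesis by auto
    next
      case False
      have second: "q ! 1 = hd zs" if pre: "prefix (hd q # zs) q" and zs: "zs \<noteq> []" for zs
      proof -
        obtain ws where "q = (hd q # zs) @ ws" using pre by (rule prefixE)
        then have "q ! 1 = ((hd q # zs) @ ws) ! 1" by (rule arg_cong)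
        then show ?thesis using zs by (simp add: nth_append hd_conv_nth)
      qed
      have "hd ys = q ! 1" using second[OF pre1 False] by simp
      moreover have "last xs = q ! 1" using second[OF pre2] xs by (simp add: hd_rev)
      ultimately have "hd ys \<in> set xs" using last_in_set[OF xs] by simp
      then show ?thesis using p'(1) False by (auto simp: xy)
    qed
  qed
qed

text \<open>Common form of the generalized stars with at least three vines and of the paths with
  \<open>2 * k\<close> edges taken as stars with two. Each vine is listed away from the center:
  \<open>hd q\<close> is a neighbor of \<open>c\<close>, \<open>last q\<close> a leaf.\<close>

locale spider =
  fixes S :: "'a pair_pre_digraph" and c :: 'a and k :: nat and V :: "'a list set"
  assumes finite_vines: "finite V" and two_vines: "2 \<le> card V" and k_pos: "0 < k"
    and vine_distinct: "q \<in> V \<Longrightarrow> distinct q"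
    and vine_length: "q \<in> V \<Longrightarrow> length q = k"
    and center_not_in_vine: "q \<in> V \<Longrightarrow> c \<notin> set q"
    and vines_disjoint: "q \<in> V \<Longrightarrow> r \<in> V \<Longrightarrow> x \<in> set q \<Longrightarrow> x \<in> set r \<Longrightarrow> q = r"
    and pverts_eq: "pverts S = insert c (\<Union>q\<in>V. set q)"
    and parcs_eq: "parcs S = (\<Union>q\<in>V. {(c, hd q), (hd q, c)} \<union> parcs (path_graph q))"
begin

lemma vine_nonempty: "q \<in> V \<Longrightarrow> q \<noteq> []"
  using vine_length[of q] k_pos by auto

lemma pair_pseudo_graph_spider: "pair_pseudo_graph S"
proof (rule pair_pseudo_graphI)
  show "finite (pverts S)" using finite_vines by (simp add: pverts_eq)
  show "parcs S \<subseteq> pverts S \<times> pverts S"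
  proof
    fix e assume "e \<in> parcs S"
    then obtain q where q: "q \<in> V" "e \<in> {(c, hd q), (hd q, c)} \<union> parcs (path_graph q)"
      by (auto simp: parcs_eq)
    then have "hd q \<in> set q" using vine_nonempty by simp
    moreover have "parcs (path_graph q) \<subseteq> set q \<times> set q"
      using pair_pseudo_graphD(2)[OF pair_pseudo_graph_path_graph] by (metis pverts_path_graph)
    ultimately show "e \<in> pverts S \<times> pverts S" using q by (auto simp: pverts_eq)
  qed
  show "(y, x) \<in> parcs S" if "(x, y) \<in> parcs S" for x y
  proof -
    from that[unfolded parcs_eq]
    obtain q where q: "q \<in> V" "(x, y) \<in> {(c, hd q), (hd q, c)} \<union> parcs (path_graph q)"
      by (rule UN_E)
    then have "(y, x) \<in> {(c, hd q), (hd q, c)} \<union> parcs (path_graph q)"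
      using pair_pseudo_graphD(3)[OF pair_pseudo_graph_path_graph, of x y q] by auto
    then show ?thesis using q(1) by (auto simp: parcs_eq)
  qed
qed

lemma adjacent_center: "adjacent S c x \<longleftrightarrow> (\<exists>q\<in>V. x = hd q)"
proof
  assume "adjacent S c x"
  then obtain q where q: "q \<in> V" "(c, x) \<in> {(c, hd q), (hd q, c)} \<union> parcs (path_graph q)"
    by (auto simp: parcs_eq)
  have "hd q \<noteq> c" using center_not_in_vine[OF q(1)] vine_nonempty[OF q(1)] hd_in_set by metis
  moreover have "(c, x) \<notin> parcs (path_graph q)"
    using center_not_in_vine[OF q(1)] pair_pseudo_graphD(2)[OF pair_pseudo_graph_path_graph, of q]
    by auto
  ultimately show "\<exists>q\<in>V. x = hd q" using q by auto
next
  assume "\<exists>q\<in>V. x = hd q"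
  then show "adjacent S c x" by (auto simp: parcs_eq)
qed

lemma adjacent_vine:
  assumes q: "q \<in> V" "x \<in> set q" and y: "y \<noteq> c"
  shows "adjacent S x y \<longleftrightarrow> adjacent (path_graph q) x y"
proof
  assume "adjacent S x y"
  then obtain r where r: "r \<in> V" "(x, y) \<in> {(c, hd r), (hd r, c)} \<union> parcs (path_graph r)"
    by (auto simp: parcs_eq)
  have "x \<noteq> c" using center_not_in_vine q by blast
  then have xy: "(x, y) \<in> parcs (path_graph r)" using r y by auto
  then have "x \<in> set r" using pair_pseudo_graphD(2)[OF pair_pseudo_graph_path_graph, of r] by auto
  then show "adjacent (path_graph q) x y" using vines_disjoint[OF q(1) r(1) q(2)] xy by simp
next
  assume "adjacent (path_graph q) x y"
  then show "adjacent S x y" using q(1) unfolding parcs_eq by (intro UN_I[of q]) simp_all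
qed

text \<open>In \<open>c # q\<close> the last vertex of \<open>q\<close> has index \<open>k\<close>,
  so index \<open>k - 1\<close> is its predecessor: a vertex of the vine for \<open>k > 1\<close>,
  the center for \<open>k = 1\<close>. If the last vertex is adjacent to \<open>c\<close>, it is the
  head of a vine, hence of \<open>q\<close> itself, and \<open>k = 1\<close>.\<close>

lemma adjacent_end:
  assumes q: "q \<in> V" and y: "adjacent S (last q) y"
  shows "y = (c # q) ! (k - 1)"
proof -
  have lq: "last q \<in> set q" "last q = q ! (k - 1)" "k - 1 < length q"
    using vine_nonempty[OF q] vine_length[OF q] k_pos by (simp_all add: last_conv_nth)
  show ?thesis
  proof (cases "y = c")
    case True
    then have "adjacent S c (last q)" using y pair_pseudo_graphD(3)[OF pair_pseudo_graph_spider] by simp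
    then obtain r where r: "r \<in> V" "last q = hd r" using adjacent_center by blast
    then have "r = q" using vines_disjoint[OF q r(1) lq(1)] vine_nonempty by auto
    then have "q ! (k - 1) = q ! 0" using r lq hd_conv_nth vine_nonempty[OF q] by metis
    then have "k - 1 = 0"
      using nth_eq_iff_index_eq[OF vine_distinct[OF q], of "k - 1" 0] vine_length[OF q] k_pos by simp
    then show ?thesis using True by simp
  next
    case False
    then have "adjacent (path_graph q) (q ! (k - 1)) y" using adjacent_vine[OF q lq(1)] y lq by simp
    from adjacent_path_graph_nth[OF vine_distinct[OF q] lq(3) this]
    show ?thesis using vine_length[OF q] k_pos by (auto simp: nth_Cons')
  qed
qed

lemma adjacent_end_iff:
  assumes q: "q \<in> V"
  shows "adjacent S (last q) y \<longleftrightarrow> y = (c # q) ! (k - 1)"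
proof
  assume y: "y = (c # q) ! (k - 1)"
  have lq: "last q = q ! (k - 1)" using vine_nonempty[OF q] vine_length[OF q] by (simp add: last_conv_nth)
  show "adjacent S (last q) y"
  proof (cases "k = 1")
    case True
    then have "last q = hd q" using lq hd_conv_nth[OF vine_nonempty[OF q]] by simp
    then show ?thesis using q y True by (auto simp: parcs_eq)
  next
    case False
    then have "Suc (k - 2) < length q" "y = q ! (k - 2)" "last q = q ! Suc (k - 2)"
      using y lq k_pos vine_length[OF q] by (auto simp: nth_Cons' numeral_2_eq_2 Suc_diff_Suc)
    then have "adjacent (path_graph q) (last q) y" unfolding parcs_path_graph by blast
    then show ?thesis using q by (auto simp: parcs_eq)
  qed
qed (rule adjacent_end[OF q])

text \<open>Different vines are connected only through \<open>c\<close>, so a walk that avoids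
  \<open>c\<close> remains in the vine where it starts.\<close>

lemma successively_in_vine:
  assumes "successively (adjacent S) a" "c \<notin> set a" "a \<noteq> []" "hd a \<in> set q" "q \<in> V"
  shows "set a \<subseteq> set q \<and> successively (adjacent (path_graph q)) a"
  using assms
proof (induction a)
  case (Cons x a)
  show ?case
  proof (cases "a = []")
    case False
    then have s: "successively (adjacent S) a" "adjacent S x (hd a)"
      using Cons.prems(1) by (simp_all add: successively_Cons)
    have x: "x \<in> set q" using Cons.prems(4) by simp
    have "hd a \<noteq> c" using Cons.prems(2) hd_in_set[OF False] by (metis list.set_intros(2))
    then have adj: "adjacent (path_graph q) x (hd a)"
      using adjacent_vine[OF Cons.prems(5) x] s(2) by simp
    then have "hd a \<in> set q"
      using pair_pseudo_graphD(2)[OF pair_pseudo_graph_path_graph, of q] by auto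
    then have "set a \<subseteq> set q \<and> successively (adjacent (path_graph q)) a"
      using Cons.IH[OF s(1) _ False] Cons.prems(2,5) by simp
    then show ?thesis using False adj x by (simp add: successively_Cons)
  next
    case True
    then show ?thesis using Cons.prems(4) by simp
  qed
qed simp

text \<open>A path leaving the center enters a vine at its head and, unable to return to
  \<open>c\<close>, can only run along it.\<close>

lemma branch_prefix:
  assumes "distinct (c # a)" "successively (adjacent S) (c # a)" "a \<noteq> []"
  obtains q where "q \<in> V" "prefix a q" "hd a = hd q"
proof -
  have "adjacent S c (hd a)" using assms by (simp add: successively_Cons)
  then obtain q where q: "q \<in> V" "hd a = hd q" using adjacent_center by blast
  then have "successively (adjacent (path_graph q)) a"
    using successively_in_vine[of a q] assms vine_nonempty by (simp add: successively_Cons)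
  then have "prefix a q"
    using path_graph_prefix[OF vine_distinct[OF q(1)]] assms q vine_nonempty by simp
  then show ?thesis using that q by blast
qed

lemma vpath_avoiding_center:
  assumes "vpath p (with_proj S)" "c \<notin> set p" "q \<in> V" "x \<in> set q" "x \<in> set p"
  shows "set p \<subseteq> set q" "vpath p (with_proj (path_graph q))"
proof -
  have p: "p \<noteq> []" "distinct p" "set p \<subseteq> pverts S" "successively (adjacent S) p"
    using assms(1) by (simp_all add: vpath_iff)
  then have "hd p \<in> pverts S" "hd p \<noteq> c" using assms(2) hd_in_set by blast+
  then obtain r where r: "r \<in> V" "hd p \<in> set r" by (auto simp: pverts_eq)
  note * = successively_in_vine[OF p(4) assms(2) p(1) r(2,1)]
  then have "q = r" using vines_disjoint[OF assms(3) r(1) assms(4)] assms(5) by blast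
  then show "set p \<subseteq> set q" "vpath p (with_proj (path_graph q))"
    using * p by (simp_all add: vpath_iff)
qed

lemma vine_end_neq: "q \<in> V \<Longrightarrow> r \<in> V \<Longrightarrow> last q \<in> set r \<Longrightarrow> q = r"
  using vines_disjoint[of q r "last q"] vine_nonempty[of q] by simp

text \<open>The part before the center is called \<open>rev a\<close> so that \<open>a\<close> and
  \<open>b\<close> are both read away from \<open>c\<close> and one analysis of branches serves
  both.\<close>

lemma center_path_split:
  assumes "vpath p (with_proj S)" "c \<in> set p"
  obtains a b where "p = rev a @ c # b" "distinct (c # a)" "distinct (c # b)"
    "set a \<inter> set b = {}" "successively (adjacent S) (c # a)" "successively (adjacent S) (c # b)"
proof -
  obtain xs ys where p: "p = xs @ c # ys" using assms(2) by (meson split_list)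
  have r: "vpath (rev p) (with_proj S)" using vpath_rev[OF pair_pseudo_graph_spider assms(1)] .
  show ?thesis
  proof (rule that[of "rev xs" ys])
    show "successively (adjacent S) (c # ys)"
      using assms(1) unfolding p by (simp add: vpath_iff successively_append_iff)
    show "successively (adjacent S) (c # rev xs)"
      using r unfolding p
      by (simp add: vpath_iff successively_append_iff del: successively_rev)
  qed (use assms(1) in \<open>auto simp: p vpath_iff\<close>)
qed

text \<open>Intended for the two branches of the path through the center. A nonempty branch touches
  exactly one vine; the vines untouched by both branches have to be covered by other paths.\<close>

definition touched :: "'a list \<Rightarrow> 'a list set" where
  "touched a = {q \<in> V. set a \<inter> set q \<noteq> {}}"

lemma touched_branch:
  assumes "distinct (c # a)" "successively (adjacent S) (c # a)"
  shows "a = [] \<and> touched a = {} \<or> (\<exists>q\<in>V. prefix a q \<and> a \<noteq> [] \<and> hd a = hd q \<and> touched a = {q})"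
proof (cases "a = []")
  case True
  then show ?thesis by (simp add: touched_def)
next
  case False
  obtain q where q: "q \<in> V" "prefix a q" "hd a = hd q" using branch_prefix[OF assms False] .
  have sub: "set a \<subseteq> set q" using q(2) by (rule set_mono_prefix)
  have "r = q" if "r \<in> V" "x \<in> set a" "x \<in> set r" for r x
    using vines_disjoint[OF that(1) q(1) that(3)] sub that(2) by blast
  moreover have "set a \<inter> set q \<noteq> {}" using sub False by (metis Int_absorb2 set_empty)
  ultimately have "touched a = {q}" using q(1) unfolding touched_def by blast
  then show ?thesis using q False by blast
qed

text \<open>Each vine outside the path through the center needs a path of its own (look at its leaf). If
  there are no further paths, then those paths are entire vines, and so are the two branches of the
  path through the center.\<close>

lemma path_covering_spider:
  assumes C: "path_covering S C"
  obtains a b where "rev a @ c # b \<in> C" "distinct (rev a @ c # b)"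
    "card V + 1 \<le> card C + (if a = [] then 0 else 1) + (if b = [] then 0 else 1)"
    "card V + 1 = card C + (if a = [] then 0 else 1) + (if b = [] then 0 else 1) \<longrightarrow>
      (a = [] \<or> a \<in> V) \<and> (b = [] \<or> b \<in> V) \<and>
      (\<forall>p \<in> C - {rev a @ c # b}. c \<notin> set p \<and> (p \<in> V \<or> rev p \<in> V))"
proof -
  have "c \<in> pverts S" by (simp add: pverts_eq)
  then obtain p0 where p0: "p0 \<in> C" "c \<in> set p0" by (rule path_covering_vertexE[OF C])
  have vp0: "vpath p0 (with_proj S)" using path_coveringD(1)[OF C p0(1)] .
  obtain a b where ab: "p0 = rev a @ c # b" "distinct (c # a)" "distinct (c # b)"
    "set a \<inter> set b = {}" "successively (adjacent S) (c # a)" "successively (adjacent S) (c # b)"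
    using center_path_split[OF vp0 p0(2)] .
  note ta = touched_branch[OF ab(2,5)] and tb = touched_branch[OF ab(3,6)]
  \<comment> \<open>The number of nonempty branches, at most two. It equals the number of touched
    vines, since two branches in the same vine would share its head.\<close>
  define t where "t = (if a = [] then 0 else 1) + (if b = [] then 0 else (1::nat))"
  define U where "U = touched a \<union> touched b"
  have UV: "U \<subseteq> V" by (auto simp: U_def touched_def)
  have tt: "touched a \<inter> touched b = {}"
  proof (rule ccontr)
    assume "touched a \<inter> touched b \<noteq> {}"
    then have "a \<noteq> []" "b \<noteq> []" "hd a = hd b" using ta tb by auto
    then show False using ab(4) hd_in_set by (metis disjoint_iff)
  qed
  have card_U: "card U = t"
  proof -
 have "finite (touched a)" "finite (touched b)"
      using finite_vines by (simp_all add: touched_def)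
    moreover have "card (touched a) = (if a = [] then 0 else 1)"
      using ta by (elim disjE conjE bexE) simp_all
    moreover have "card (touched b) = (if b = [] then 0 else 1)"
      using tb by (elim disjE conjE bexE) simp_all
    ultimately show ?thesis using tt by (simp add: U_def t_def card_Un_disjoint)
  qed
  have untouched: "set q \<inter> set p0 = {}" if "q \<in> V - U" for q
    using that center_not_in_vine[of q] by (auto simp: U_def touched_def ab(1))
  have "\<exists>p. p \<in> C \<and> last q \<in> set p" if "q \<in> V" for q
  proof -
    have "last q \<in> set q" using vine_nonempty[OF that] by simp
    then have "last q \<in> pverts S" using that by (auto simp: pverts_eq)
    then show ?thesis using path_covering_vertexE[OF C] by metis
  qed
  \<comment> \<open>\<open>g\<close> sends a vine to the path that covers its leaf. On untouched
    vines this path avoids the center and stays inside the vine, so \<open>g\<close> is injective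
    there and misses \<open>p0\<close>.\<close>
  then obtain g where g: "\<And>q. q \<in> V \<Longrightarrow> g q \<in> C \<and> last q \<in> set (g q)" by metis
  have g_neq: "g q \<in> C - {p0}" if "q \<in> V - U" for q
  proof -
    have "q \<in> V" using that by simp
    then have "last q \<in> set q" "g q \<in> C" "last q \<in> set (g q)" using g vine_nonempty by simp_all
    then show ?thesis using untouched[OF that] by blast
  qed
  have center: "c \<notin> set p" if "p \<in> C - {p0}" for p
    using path_coveringD(2)[OF C p0(1) _ p0(2)] that by blast
  have g_sub: "set (g q) \<subseteq> set q" and g_path: "vpath (g q) (with_proj (path_graph q))"
    if q: "q \<in> V - U" for q
  proof -
    have v: "vpath (g q) (with_proj S)" "c \<notin> set (g q)" "q \<in> V"
      using path_coveringD(1)[OF C, of "g q"] g_neq[OF q] center[of "g q"] q by simp_all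
    have l: "last q \<in> set q" "last q \<in> set (g q)" using g[OF v(3)] vine_nonempty[OF v(3)] by auto
    show "set (g q) \<subseteq> set q" "vpath (g q) (with_proj (path_graph q))"
      using vpath_avoiding_center[OF v l] .
  qed
  have inj: "inj_on g (V - U)"
  proof (rule inj_onI)
    fix q r assume q: "q \<in> V - U" and r: "r \<in> V - U" and "g q = g r"
    then have "last q \<in> set r" using g[of q] g_sub[OF r] by auto
    then show "q = r" using vine_end_neq q r by blast
  qed
  have fin: "finite C"
    using finite_path_covering[OF C] pair_pseudo_graphD(1)[OF pair_pseudo_graph_spider] by simp
  have img: "g ` (V - U) \<subseteq> C - {p0}" using g_neq by blast
  have c1: "card (V - U) = card V - t" "t \<le> card V"
    using card_Diff_subset[OF finite_subset[OF UV finite_vines] UV] card_U card_mono[OF finite_vines UV]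
    by simp_all
  have c2: "card (C - {p0}) = card C - 1" "0 < card C" using p0(1) fin by (auto simp: card_gt_0_iff)
  have "card (V - U) \<le> card (C - {p0})" using card_inj_on_le[OF inj img] fin by simp
  then have le: "card V + 1 \<le> card C + t" using c1 c2 by linarith
  show thesis
  proof (rule that[of a b])
    show "rev a @ c # b \<in> C" using p0 ab(1) by simp
    show "distinct (rev a @ c # b)" using vp0 ab(1) by (simp add: vpath_iff)
    show "card V + 1 \<le> card C + (if a = [] then 0 else 1) + (if b = [] then 0 else 1)"
      using le by (simp add: t_def)
    show "card V + 1 = card C + (if a = [] then 0 else 1) + (if b = [] then 0 else 1) \<longrightarrow>
      (a = [] \<or> a \<in> V) \<and> (b = [] \<or> b \<in> V) \<and>
      (\<forall>p \<in> C - {rev a @ c # b}. c \<notin> set p \<and> (p \<in> V \<or> rev p \<in> V))"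
    proof
      assume "card V + 1 = card C + (if a = [] then 0 else 1) + (if b = [] then 0 else 1)"
      then have "card V + 1 = card C + t" by (simp add: t_def)
      then have "card (g ` (V - U)) = card (C - {p0})" using card_image[OF inj] c1 c2 by linarith
      \<comment> \<open>In the case of equality the injection is onto: every path other than
        \<open>p0\<close> lies inside an untouched vine and is the only path of that kind
        there.\<close>
      then have surj: "g ` (V - U) = C - {p0}" using card_subset_eq[OF _ img] fin by simp
      have cover: "x \<in> set p0 \<or> q \<in> V - U \<and> x \<in> set (g q)" if q: "q \<in> V" "x \<in> set q" for q x
      proof -
        have "x \<in> pverts S" using q by (auto simp: pverts_eq)
        then obtain p where p: "p \<in> C" "x \<in> set p" by (rule path_covering_vertexE[OF C])
        show ?thesis
        proof (cases "p = p0")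
          case False
          then have "p \<in> g ` (V - U)" using surj p(1) by simp
          then obtain r where r: "r \<in> V - U" "p = g r" by blast
          then have "x \<in> set r" using g_sub[OF r(1)] p(2) by blast
          then have "q = r" using vines_disjoint[OF q(1) _ q(2)] r(1) by simp
          then show ?thesis using r p(2) by simp
        qed (use p in simp)
      qed
      \<comment> \<open>Applied with \<open>d\<close> one of the branches \<open>a\<close>,
        \<open>b\<close> and \<open>q\<close> the vine it touches. No path other than
        \<open>p0\<close> reaches a touched vine, and \<open>p0\<close> meets \<open>q\<close> only
        in \<open>d\<close>, so the prefix \<open>d\<close> contains all of
        \<open>q\<close>.\<close>
      have whole: "d \<in> V" if pre: "prefix d q" and q: "q \<in> V" "q \<in> U"
        and d: "set q \<inter> set p0 \<subseteq> set d" for d q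
      proof -
        have "set q \<subseteq> set p0" using cover q by blast
        then have "set q \<subseteq> set d" using d by blast
        moreover have "distinct d" using pre vine_distinct[OF q(1)] by (auto elim!: prefixE)
        ultimately have "length q \<le> length d"
          using distinct_card[OF vine_distinct[OF q(1)]] distinct_card[of d] card_mono[of "set d" "set q"]
          by simp
        then have "d = q" using pre by (auto elim!: prefixE)
        then show ?thesis using q by simp
      qed
      have dis: "set q \<inter> set d = {}" if "q \<in> V" "q \<notin> touched d" for q d
        using that by (auto simp: touched_def)
      have "a \<in> V" if ne: "a \<noteq> []"
      proof -
        obtain q where q: "q \<in> V" "prefix a q" "touched a = {q}" using ta ne by blast
        then have "set q \<inter> set b = {}" "c \<notin> set q"
          using dis[of q b] tt center_not_in_vine by auto
        then show ?thesis using whole[OF q(2,1)] q(3) ab(1) by (auto simp: U_def)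
      qed
      moreover have "b \<in> V" if ne: "b \<noteq> []"
      proof -
        obtain q where q: "q \<in> V" "prefix b q" "touched b = {q}" using tb ne by blast
        then have "set q \<inter> set a = {}" "c \<notin> set q"
          using dis[of q a] tt center_not_in_vine by auto
        then show ?thesis using whole[OF q(2,1)] q(3) ab(1) by (auto simp: U_def)
      qed
      moreover have "c \<notin> set p \<and> (p \<in> V \<or> rev p \<in> V)" if p: "p \<in> C - {p0}" for p
      proof -
        obtain q where q: "q \<in> V - U" "p = g q" using p surj by blast
        \<comment> \<open>An untouched vine is covered by \<open>g q\<close> alone, which therefore
          spans it and is the vine in one of its two directions.\<close>
        have "set q \<subseteq> set (g q)" using cover[of q] untouched[OF q(1)] q(1) by blast
        then have "set (g q) = set q" using g_sub[OF q(1)] by blast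
        then have "g q = q \<or> g q = rev q"
          using vpath_path_graph_spanning[OF vine_distinct g_path[OF q(1)]] q(1) by simp
        then show ?thesis using center[OF p] q by auto
      qed
      ultimately show "(a = [] \<or> a \<in> V) \<and> (b = [] \<or> b \<in> V) \<and>
        (\<forall>p \<in> C - {rev a @ c # b}. c \<notin> set p \<and> (p \<in> V \<or> rev p \<in> V))"
        unfolding ab(1) by blast
    qed
  qed
qed

text \<open>Two vines are joined through the center and every other vine is a path by itself. The
  count is written without subtraction.\<close>

lemma ex_path_covering_spider: "\<exists>C. path_covering S C \<and> card C + 1 = card V"
proof -
  obtain W where "W \<subseteq> V" "card W = 2" using two_vines obtain_subset_with_card_n by metis
  then obtain q r where qr: "q \<in> V" "r \<in> V" "q \<noteq> r" by (metis card_2_iff insert_subset)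
  define p0 where "p0 = rev q @ c # r"
  define C where "C = insert p0 (V - {q, r})"
  have path: "successively (adjacent S) s" if "s \<in> V" for s
  proof (rule successively_mono)
    show "successively (adjacent (path_graph s)) s"
      using vpath_path_graph[OF vine_distinct[OF that] vine_nonempty[OF that]] by (simp add: vpath_iff)
    show "adjacent S x y" if "adjacent (path_graph s) x y" for x y
      using that \<open>s \<in> V\<close> by (auto simp: parcs_eq)
  qed
  have revpath: "successively (adjacent S) (rev q)"
  proof -
    have "vpath q (with_proj S)"
      using path[OF qr(1)] vine_nonempty vine_distinct qr(1) by (auto simp: vpath_iff pverts_eq)
    then show ?thesis using vpath_rev[OF pair_pseudo_graph_spider] by (auto simp only: vpath_iff)
  qed
  have dis: "set q \<inter> set r = {}" using vines_disjoint[OF qr(1,2)] qr(3) by blast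
  have "path_covering S C"
  proof (rule path_coveringI)
    fix p assume p: "p \<in> C"
    show "vpath p (with_proj S)"
    proof (cases "p = p0")
      case True
      have "distinct p0"
        using vine_distinct[OF qr(1)] vine_distinct[OF qr(2)] dis
          center_not_in_vine[OF qr(1)] center_not_in_vine[OF qr(2)]
        by (auto simp: p0_def)
      moreover have "adjacent S (hd q) c" "adjacent S c (hd r)" using qr by (auto simp: parcs_eq)
      then have "successively (adjacent S) p0"
        using path[OF qr(2)] revpath vine_nonempty[OF qr(1)]
        by (simp add: p0_def successively_append_iff successively_Cons last_rev del: successively_rev)
      moreover have "set p0 \<subseteq> pverts S" using qr by (auto simp: p0_def pverts_eq)
      ultimately show ?thesis using True by (auto simp: vpath_iff p0_def)
    next
      case False
      then have "p \<in> V" using p by (simp add: C_def)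
      then show ?thesis using path vine_nonempty vine_distinct by (auto simp: vpath_iff pverts_eq)
    qed
  next
    fix p p' x assume *: "p \<in> C" "p' \<in> C" "x \<in> set p" "x \<in> set p'"
    have p0: "x \<notin> set p0" if "s \<in> V - {q, r}" "x \<in> set s" for s
      using that vines_disjoint[of s q x] vines_disjoint[of s r x] center_not_in_vine[of s] qr
      by (auto simp: p0_def)
    show "p = p'"
    proof (cases "p = p0")
      case True
      then show ?thesis using p0[of p'] * by (auto simp: C_def)
    next
      case False
      then have "p \<in> V - {q, r}" using * by (simp add: C_def)
      moreover have "p' \<in> V" using p0[of p] calculation * by (auto simp: C_def)
      ultimately show ?thesis using vines_disjoint[of p p' x] * by simp
    qed
  next
    show "(\<Union>p\<in>C. set p) = pverts S" using qr by (auto simp: C_def p0_def pverts_eq)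
  qed
  moreover have "p0 \<notin> V" using center_not_in_vine[of p0] by (auto simp: p0_def)
  then have "card C = Suc (card V - 2)"
    using qr finite_vines by (simp add: C_def card_Diff_subset)
  ultimately show ?thesis using two_vines by (intro exI[of _ C]) simp
qed

text \<open>The lower bound holds because the path through the center has at most two nonempty
  branches.\<close>

lemma path_cover_number_spider: "path_cover_number S + 1 = card V"
proof (rule antisym)
  show "path_cover_number S + 1 \<le> card V"
    using ex_path_covering_spider path_cover_number_le by fastforce
  obtain C where C: "min_path_covering S C" using ex_min_path_covering by blast
  then have "path_covering S C" by (simp add: min_path_covering_def)
  then have "card V + 1 \<le> card C + 2"
    by (rule path_covering_spider) (auto split: if_splits)
  then show "card V \<le> path_cover_number S + 1" using C by (simp add: min_path_covering_def)
qed

end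

section \<open>Path lengths and labels at path ends in coverings of a spider\<close>

lemma out_degree_eq: "out_degree (with_proj G) v = card {w. adjacent G v w}"
proof -
  have "out_arcs (with_proj G) v = Pair v ` {w. adjacent G v w}"
    by (auto simp: out_arcs_def)
  then show ?thesis unfolding out_degree_def by (simp add: card_image inj_on_def)
qed

lemma leaf_iff: "leaf G v \<longleftrightarrow> v \<in> pverts G \<and> card {w. adjacent G v w} = 1"
  by (simp add: leaf_def out_degree_eq)

lemma heavy_iff: "heavy G v \<longleftrightarrow> v \<in> pverts G \<and> 2 < card {w. adjacent G v w}"
  by (simp add: heavy_def out_degree_eq)

lemma path_lengths_eq:
  assumes "finite C" "p \<in> C" "\<And>q. q \<in> C - {p} \<Longrightarrow> length q = k"
  shows "path_lengths C = {#length p#} + replicate_mset (card C - 1) k"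
proof -
  have "path_lengths C = {#length p#} + path_lengths (C - {p})"
    using assms(1,2) by (simp add: path_lengths_def mset_set.remove)
  also have "path_lengths (C - {p}) = image_mset (\<lambda>_. k) (mset_set (C - {p}))"
    unfolding path_lengths_def using assms(1,3) by (intro image_mset_cong) auto
  also have "\<dots> = replicate_mset (card C - 1) k"
    using assms(1,2) by (simp add: image_mset_const_eq)
  finally show ?thesis .
qed

lemma path_lengths_Un:
  "finite C \<Longrightarrow> finite D \<Longrightarrow> C \<inter> D = {} \<Longrightarrow> path_lengths (C \<union> D) = path_lengths C + path_lengths D"
  by (simp add: path_lengths_def mset_set_Union)

lemma path_lengths_remove:
  "finite C \<Longrightarrow> p \<in> C \<Longrightarrow> path_lengths C = add_mset (length p) (path_lengths (C - {p}))"
  by (simp add: path_lengths_def mset_set.remove)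

text \<open>If one end is labeled B, the first two conditions on it, with the exclusion of A, say
  that the other end is unlabeled. This is what remains visible after a new star has been glued to
  the B end. The star containing \<open>w\<close> is looked up in \<open>Q\<close>, since the labels
  do not determine it.\<close>

definition well_ended ::
  "'a labeling \<Rightarrow> ('a pair_pre_digraph \<times> nat) set \<Rightarrow> 'a list \<Rightarrow> bool" where
  "well_ended L Q p \<longleftrightarrow>
     (\<forall>w\<in>ends p. L w \<noteq> Some Label_A \<and>
       (L w = Some Label_B \<longrightarrow>
          hd p \<noteq> last p \<and> (\<forall>x\<in>set p. L x = Some Label_B \<longrightarrow> x = w) \<and>
          (\<forall>G k. (G, k) \<in> Q \<longrightarrow> w \<in> pverts G \<longrightarrow> length p = k)))"

lemma well_ended_rev [simp]: "well_ended L Q (rev p) \<longleftrightarrow> well_ended L Q p"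
  by (cases "p = []") (auto simp: well_ended_def hd_rev last_rev)

lemma well_ended_unlabeled: "(\<And>w. w \<in> ends p \<Longrightarrow> L w = None) \<Longrightarrow> well_ended L Q p"
  by (simp add: well_ended_def)

lemma ends_subset: "p \<noteq> [] \<Longrightarrow> ends p \<subseteq> set p"
  by (simp add: ends_def)

context spider
begin

lemma label_vine_last: "q \<in> V \<Longrightarrow> star_labeling S c (last q) = None"
proof -
  assume "q \<in> V"
  then have "{w. adjacent S (last q) w} = {(c # q) ! (k - 1)}" using adjacent_end_iff by blast
  then show ?thesis by (simp add: star_labeling_def leaf_iff)
qed

lemma label_vine_hd: "q \<in> V \<Longrightarrow> star_labeling S c (hd q) \<noteq> Some Label_A"
  using adjacent_center by (auto simp: star_labeling_def)

text \<open>For \<open>k = 1\<close> the neighbors of the center are leaves and remain unlabeled, so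
  a label B makes the head of the vine different from its last vertex.\<close>

lemma label_B:
  assumes "star_labeling S c x = Some Label_B"
  obtains q where "q \<in> V" "x = hd q" "hd q \<noteq> last q"
proof -
  have "adjacent S c x" using assms by (auto simp: star_labeling_def split: if_splits)
  then obtain q where q: "q \<in> V" "x = hd q" using adjacent_center by blast
  moreover have "hd q \<noteq> last q" using label_vine_last[OF q(1)] assms q(2) by auto
  ultimately show ?thesis by (rule that)
qed

text \<open>One end of a vine is a leaf and the other a neighbor of the center, the only vertex of
  the vine that can be labeled B.\<close>

lemma well_ended_vine:
  assumes "p \<in> V \<or> rev p \<in> V"
  shows "well_ended (star_labeling S c) {(S, k)} p"
proof -
  have *: "well_ended (star_labeling S c) {(S, k)} q" if q: "q \<in> V" for q
    unfolding well_ended_def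
  proof (intro ballI conjI impI allI)
    fix w assume "w \<in> ends q"
    then have w: "w = hd q \<or> w = last q" by (simp add: ends_def)
    then show "star_labeling S c w \<noteq> Some Label_A"
      using label_vine_hd[OF q] label_vine_last[OF q] by auto
    assume B: "star_labeling S c w = Some Label_B"
    then show "hd q \<noteq> last q" using w label_vine_last[OF q] by auto
    have w: "w = hd q" using w B label_vine_last[OF q] by auto
    show "x = w" if x: "x \<in> set q" "star_labeling S c x = Some Label_B" for x
    proof -
      obtain r where r: "r \<in> V" "x = hd r" using label_B[OF x(2)] by blast
      then have "q = r" using vines_disjoint[OF q r(1) x(1)] vine_nonempty[OF r(1)] by simp
      then show ?thesis using r w by simp
    qed
    show "length q = k'" if "(G, k') \<in> {(S, k)}" for G k' using that vine_length[OF q] by simp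
  qed
  show ?thesis using assms *[of p] *[of "rev p"] by auto
qed

text \<open>With \<open>card V - 1\<close> paths the bound of \<open>path_covering_spider\<close>
  needs both branches nonempty and holds with equality. So the path through the center is two whole
  vines with \<open>c\<close> between them, ending in two leaves, and the other paths are
  vines.\<close>

lemma min_path_covering_spider:
  assumes "min_path_covering S C"
  shows "path_lengths C = add_mset (2 * k + 1) (replicate_mset (card V - 2) k)"
    and "p \<in> C \<Longrightarrow> well_ended (star_labeling S c) {(S, k)} p"
proof -
  have C: "path_covering S C" and card: "card C + 1 = card V"
    using assms path_cover_number_spider by (simp_all add: min_path_covering_def)
  obtain a b where ab: "rev a @ c # b \<in> C" "distinct (rev a @ c # b)"
    "card V + 1 \<le> card C + (if a = [] then 0 else 1) + (if b = [] then 0 else 1)"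
    "card V + 1 = card C + (if a = [] then 0 else 1) + (if b = [] then 0 else 1) \<longrightarrow>
      (a = [] \<or> a \<in> V) \<and> (b = [] \<or> b \<in> V) \<and>
      (\<forall>p \<in> C - {rev a @ c # b}. c \<notin> set p \<and> (p \<in> V \<or> rev p \<in> V))"
    using path_covering_spider[OF C] .
  have ne: "a \<noteq> []" "b \<noteq> []" using ab(3) card by (auto split: if_splits)
  then have V: "a \<in> V" "b \<in> V" "\<And>p. p \<in> C - {rev a @ c # b} \<Longrightarrow> p \<in> V \<or> rev p \<in> V"
    using ab(4) card by auto
  have fin: "finite C"
    using finite_path_covering[OF C] pair_pseudo_graphD(1)[OF pair_pseudo_graph_spider] by simp
  have "length q = k" if "q \<in> C - {rev a @ c # b}" for q
    using V(3)[OF that] vine_length[of q] vine_length[of "rev q"] by auto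
  from path_lengths_eq[OF fin ab(1) this]
  show "path_lengths C = add_mset (2 * k + 1) (replicate_mset (card V - 2) k)"
    using vine_length[OF V(1)] vine_length[OF V(2)] unfolding card[symmetric] by (simp add: mult_2)
  have "well_ended (star_labeling S c) {(S, k)} (rev a @ c # b)"
  proof (rule well_ended_unlabeled)
    fix w assume "w \<in> ends (rev a @ c # b)"
    then have "w = last a \<or> w = last b" using ne by (auto simp: ends_def hd_rev)
    then show "star_labeling S c w = None" using label_vine_last V(1,2) by auto
  qed
  then show "well_ended (star_labeling S c) {(S, k)} p" if "p \<in> C"
    using that V(3)[of p] well_ended_vine[of p] by auto
qed

text \<open>If \<open>c\<close> is an end, one branch is empty and the bound rises by one. A
  covering just one above the minimum attains it: its paths are the vines, one of them extended by
  \<open>c\<close>. The end \<open>c\<close> is exempted from the label condition because it becomes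
  an interior vertex once the path is glued to the bridge.\<close>

lemma path_covering_spider_center_end:
  assumes C: "path_covering S C" and p: "p \<in> C" "c \<in> ends p"
  shows "path_cover_number S < card C"
    and "card C = Suc (path_cover_number S) \<Longrightarrow>
      length p = Suc k \<and> path_lengths C = add_mset (Suc k) (replicate_mset (card V - 1) k) \<and>
      (\<forall>w\<in>ends p. w = c \<or> star_labeling S c w = None) \<and>
      (\<forall>q\<in>C - {p}. well_ended (star_labeling S c) {(S, k)} q)"
proof -
  obtain a b where ab: "rev a @ c # b \<in> C" "distinct (rev a @ c # b)"
    "card V + 1 \<le> card C + (if a = [] then 0 else 1) + (if b = [] then 0 else 1)"
    "card V + 1 = card C + (if a = [] then 0 else 1) + (if b = [] then 0 else 1) \<longrightarrow>
      (a = [] \<or> a \<in> V) \<and> (b = [] \<or> b \<in> V) \<and>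
      (\<forall>p \<in> C - {rev a @ c # b}. c \<notin> set p \<and> (p \<in> V \<or> rev p \<in> V))"
    using path_covering_spider[OF C] .
  have "c \<in> set p" using p ends_subset path_covering_paths(1)[OF C p(1)] by blast
  then have p_eq: "p = rev a @ c # b" using path_coveringD(2)[OF C p(1) ab(1)] by simp
  have ne: "a = [] \<or> b = []"
  proof (rule ccontr)
    assume "\<not> (a = [] \<or> b = [])"
    then have "hd p \<in> set a" "last p \<in> set b" unfolding p_eq by (simp_all add: hd_rev)
    then show False using p(2) ab(2) by (auto simp: ends_def)
  qed
  then show "path_cover_number S < card C"
    using ab(3) path_cover_number_spider by (auto split: if_splits)
  assume card: "card C = Suc (path_cover_number S)"
  then have cardV: "card C = card V" using path_cover_number_spider by simp
  then have one: "(a = []) \<noteq> (b = [])" using ab(3) ne by (auto split: if_splits)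
  have V: "a = [] \<or> a \<in> V" "b = [] \<or> b \<in> V" "\<And>q. q \<in> C - {p} \<Longrightarrow> q \<in> V \<or> rev q \<in> V"
    using ab(4) cardV one unfolding p_eq by auto
  have fin: "finite C"
    using finite_path_covering[OF C] pair_pseudo_graphD(1)[OF pair_pseudo_graph_spider] by simp
  have len: "length p = Suc k" using V(1,2) one vine_length unfolding p_eq by auto
  have "length q = k" if "q \<in> C - {p}" for q
    using V(3)[OF that] vine_length[of q] vine_length[of "rev q"] by auto
  from path_lengths_eq[OF fin p(1) this]
  have "path_lengths C = add_mset (Suc k) (replicate_mset (card V - 1) k)" using len cardV by simp
  moreover have "w = c \<or> star_labeling S c w = None" if w: "w \<in> ends p" for w
  proof (cases "a = []")
    case True
    then have "w = c \<or> w = last b" "b \<in> V" using w one V(2) by (auto simp: ends_def p_eq)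
    then show ?thesis using label_vine_last by auto
  next
    case False
    then have "w = c \<or> w = last a" "a \<in> V" using w one V(1) by (auto simp: ends_def p_eq hd_rev)
    then show ?thesis using label_vine_last by auto
  qed
  moreover have "well_ended (star_labeling S c) {(S, k)} q" if "q \<in> C - {p}" for q
    using well_ended_vine V(3)[OF that] .
  ultimately show "length p = Suc k \<and>
      path_lengths C = add_mset (Suc k) (replicate_mset (card V - 1) k) \<and>
      (\<forall>w\<in>ends p. w = c \<or> star_labeling S c w = None) \<and>
      (\<forall>q\<in>C - {p}. well_ended (star_labeling S c) {(S, k)} q)"
    using len by simp
qed

end

section \<open>The invariant of the construction\<close>

text \<open>The inclusions for \<open>L\<close> and \<open>Q\<close> keep labels and recorded stars
  inside \<open>T\<close>, so that two pieces on disjoint vertex sets do not affect each other's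
  \<open>well_ended\<close>. The multiset \<open>M\<close> is chosen before \<open>C\<close>: it is
  the common value for all minimum coverings.\<close>

definition rigid ::
  "'a pair_pre_digraph \<Rightarrow> 'a labeling \<Rightarrow> ('a pair_pre_digraph \<times> nat) set \<Rightarrow> bool" where
  "rigid T L Q \<longleftrightarrow>
     pair_pseudo_graph T \<and> dom L \<subseteq> pverts T \<and> (\<forall>G k. (G, k) \<in> Q \<longrightarrow> pverts G \<subseteq> pverts T) \<and>
     (\<exists>M. \<forall>C. min_path_covering T C \<longrightarrow> path_lengths C = M \<and> (\<forall>p\<in>C. well_ended L Q p))"

lemma rigidD:
  assumes "rigid T L Q"
  shows "pair_pseudo_graph T" "dom L \<subseteq> pverts T" "\<And>G k. (G, k) \<in> Q \<Longrightarrow> pverts G \<subseteq> pverts T"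
    "\<And>C p. min_path_covering T C \<Longrightarrow> p \<in> C \<Longrightarrow> well_ended L Q p"
proof -
  show "pair_pseudo_graph T" "dom L \<subseteq> pverts T"
    using assms unfolding rigid_def by simp_all
  show "pverts G \<subseteq> pverts T" if "(G, k) \<in> Q" for G k
    using assms that unfolding rigid_def by blast
  show "well_ended L Q p" if "min_path_covering T C" "p \<in> C" for C p
    using assms that unfolding rigid_def by blast
qed

lemma rigid_path_lengths:
  assumes "rigid T L Q"
  obtains M where "\<forall>C. min_path_covering T C \<longrightarrow> path_lengths C = M"
proof -
  from assms obtain M where
    "\<forall>C. min_path_covering T C \<longrightarrow> path_lengths C = M \<and> (\<forall>p\<in>C. well_ended L Q p)"
    unfolding rigid_def by blast
  then show ?thesis by (intro that[of M]) simp
qed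

text \<open>Neither \<open>LS\<close> nor \<open>QS\<close> says anything about vertices of
  \<open>X\<close>.\<close>

lemma well_ended_join_left:
  assumes "well_ended L Q p" "p \<noteq> []" "set p \<subseteq> X" "X \<inter> Y = {}" "dom LS \<subseteq> Y"
    and "\<And>G k. (G, k) \<in> QS \<Longrightarrow> pverts G \<subseteq> Y"
  shows "well_ended (L ++ LS) (Q \<union> QS) p"
proof -
  have L: "(L ++ LS) x = L x" if "x \<in> set p" for x
    using that assms(3-5) by (intro map_add_dom_app_simps(3)) auto
  have Q: "(G, k) \<in> Q" if "(G, k) \<in> Q \<union> QS" "x \<in> set p" "x \<in> pverts G" for x G k
    using that assms(3,4) assms(6)[of G k] by blast
  show ?thesis
    unfolding well_ended_def
  proof (intro ballI conjI impI allI)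
    fix w assume w: "w \<in> ends p"
    then have wp: "w \<in> set p" using ends_subset[OF assms(2)] by blast
    show "(L ++ LS) w \<noteq> Some Label_A" using assms(1) w L[OF wp] by (simp add: well_ended_def)
    assume "(L ++ LS) w = Some Label_B"
    then have B: "L w = Some Label_B" using L[OF wp] by simp
    show "hd p \<noteq> last p" using assms(1) w B by (simp add: well_ended_def)
    show "x = w" if "x \<in> set p" "(L ++ LS) x = Some Label_B" for x
      using assms(1) w B L[OF that(1)] that by (simp add: well_ended_def)
    show "length p = k" if "(G, k) \<in> Q \<union> QS" "w \<in> pverts G" for G k
      using assms(1) w B Q[OF that(1) wp that(2)] that(2) unfolding well_ended_def by blast
  qed
qed

text \<open>\<open>++\<close> lets its right argument prevail, but the domains are disjoint, so the
  two labelings commute and the left version applies.\<close>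

lemma well_ended_join_right:
  assumes "well_ended LS QS p" "p \<noteq> []" "set p \<subseteq> Y" "X \<inter> Y = {}" "dom L \<subseteq> X" "dom LS \<subseteq> Y"
    and "\<And>G k. (G, k) \<in> Q \<Longrightarrow> pverts G \<subseteq> X"
  shows "well_ended (L ++ LS) (Q \<union> QS) p"
proof -
  have "well_ended (LS ++ L) (QS \<union> Q) p"
    using assms(1-3) _ assms(5,7)
  proof (rule well_ended_join_left)
    show "Y \<inter> X = {}" using assms(4) by blast
  qed
  moreover have "L ++ LS = LS ++ L" using assms(4-6) by (intro map_add_comm) blast
  ultimately show ?thesis by (simp add: Un_commute)
qed

text \<open>Serves operations of type 1 and type 2 alike: of the new piece it uses only rigidity and
  the extra cost of ending a path in \<open>v\<close>. The case of a used bridge is contradictory,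
  as \<open>u\<close> would be an end labeled A.\<close>

lemma rigid_join:
  assumes rigid_T: "rigid T L Q" and rigid_S: "rigid S LS QS" and disj: "pverts T \<inter> pverts S = {}"
    and u_T: "u \<in> pverts T" and label_u: "L u = Some Label_A" and v_S: "v \<in> pverts S"
    and v_cost: "\<And>C p. path_covering S C \<Longrightarrow> p \<in> C \<Longrightarrow> v \<in> ends p \<Longrightarrow> path_cover_number S < card C"
  shows "rigid (join_by_edge T S u v) (L ++ LS) (Q \<union> QS)"
proof -
  interpret bridge T S u v
    using rigidD(1)[OF rigid_T] rigidD(1)[OF rigid_S] disj u_T v_S by (intro bridge.intro)
  obtain M where "\<forall>C. min_path_covering T C \<longrightarrow> path_lengths C = M"
    using rigid_path_lengths[OF rigid_T] .
  note M = this[rule_format]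
  obtain MS where "\<forall>C. min_path_covering S C \<longrightarrow> path_lengths C = MS"
    using rigid_path_lengths[OF rigid_S] .
  note MS = this[rule_format]
  have "path_lengths C = M + MS \<and> (\<forall>p\<in>C. well_ended (L ++ LS) (Q \<union> QS) p)"
    if C: "min_path_covering J C" for C
    using v_cost C
  proof (rule min_path_covering_join)
    fix CT CS
    assume CT: "min_path_covering T CT" and CS: "min_path_covering S CS"
      and C: "C = CT \<union> CS" "CT \<inter> CS = {}"
    have cov: "path_covering T CT" "path_covering S CS"
      using CT CS by (simp_all add: min_path_covering_def)
    have "path_lengths C = M + MS"
      using path_lengths_Un[OF _ _ C(2)] M[OF CT] MS[OF CS] C(1)
        finite_path_covering[OF cov(1)] finite_path_covering[OF cov(2)]
        pair_pseudo_graphD(1)[OF rigidD(1)[OF rigid_T]] pair_pseudo_graphD(1)[OF rigidD(1)[OF rigid_S]]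
      by simp
    moreover have "well_ended (L ++ LS) (Q \<union> QS) p" if "p \<in> CT" for p
      using rigidD(4)[OF rigid_T CT that] path_covering_paths(1,3)[OF cov(1) that] disj
        rigidD(2)[OF rigid_S] rigidD(3)[OF rigid_S]
      by (rule well_ended_join_left)
    moreover have "well_ended (L ++ LS) (Q \<union> QS) p" if "p \<in> CS" for p
      using rigidD(4)[OF rigid_S CS that] path_covering_paths(1,3)[OF cov(2) that] disj
        rigidD(2)[OF rigid_T] rigidD(2)[OF rigid_S] rigidD(3)[OF rigid_T]
      by (rule well_ended_join_right)
    ultimately show ?thesis using C(1) by blast
  next
    fix CT a assume CT: "min_path_covering T CT" "a \<in> CT" "last a = u"
    then have "u \<in> ends a" by (simp add: ends_def)
    then show ?thesis using rigidD(4)[OF rigid_T CT(1,2)] label_u by (simp add: well_ended_def)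
  qed
  moreover have "dom (L ++ LS) \<subseteq> pverts J" using rigidD(2)[OF rigid_T] rigidD(2)[OF rigid_S] by auto
  moreover have "pverts G \<subseteq> pverts J" if "(G, k) \<in> Q \<union> QS" for G k
    using that rigidD(3)[OF rigid_T, of G k] rigidD(3)[OF rigid_S, of G k] by auto
  ultimately show ?thesis using pair_pseudo_graph_join unfolding rigid_def by blast
qed

lemma dom_star_labeling: "dom (star_labeling S c) \<subseteq> pverts S"
  by (auto simp: star_labeling_def split: if_splits)

lemma dom_path_labeling: "dom (path_labeling P) \<subseteq> pverts P"
  by (auto simp: path_labeling_def split: if_splits)

lemma (in spider) rigid_spider: "rigid S (star_labeling S c) {(S, k)}"
  unfolding rigid_def
proof (intro conjI exI allI impI ballI)
  show "path_lengths C = add_mset (2 * k + 1) (replicate_mset (card V - 2) k)"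
    if "min_path_covering S C" for C
    using that by (rule min_path_covering_spider(1))
  show "well_ended (star_labeling S c) {(S, k)} p" if "min_path_covering S C" "p \<in> C" for C p
    using that by (rule min_path_covering_spider(2))
qed (use pair_pseudo_graph_spider dom_star_labeling[of S c] in auto)

text \<open>A minimum covering that uses the new edge cuts one vine of \<open>S\<close> off the center. That vine takes
  the place of the path ending in \<open>u\<close>, which has the same length, so the path lengths do not change.\<close>

lemma rigid_join_spider:
  assumes rigid_T: "rigid T L Q" and spider: "spider S v k V" and disj: "pverts T \<inter> pverts S = {}"
    and u_T: "u \<in> pverts T" and label_u: "L u = Some Label_B" "(G, k) \<in> Q" "u \<in> pverts G"
  shows "rigid (join_by_edge T S u v) (L ++ star_labeling S v) (insert (S, k) Q)"
proof -
  interpret S: spider S v k V by (rule spider)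
  have rigid_S: "rigid S (star_labeling S v) {(S, k)}" by (rule S.rigid_spider)
  have vS: "v \<in> pverts S" by (simp add: S.pverts_eq)
  interpret bridge T S u v
    using rigidD(1)[OF rigid_T] rigidD(1)[OF rigid_S] disj u_T vS by (intro bridge.intro)
  obtain M where "\<forall>C. min_path_covering T C \<longrightarrow> path_lengths C = M"
    using rigid_path_lengths[OF rigid_T] .
  note M = this[rule_format]
  have finT: "finite (pverts T)" and finS: "finite (pverts S)"
    using pair_pseudo_graphD(1)[OF rigidD(1)[OF rigid_T]] pair_pseudo_graphD(1)[OF rigidD(1)[OF rigid_S]] .
  let ?L = "L ++ star_labeling S v" and ?Q = "Q \<union> {(S, k)}"
  let ?MS = "add_mset (2 * k + 1) (replicate_mset (card V - 2) k)"
  have left: "well_ended ?L ?Q p" if "well_ended L Q p" "p \<noteq> []" "set p \<subseteq> pverts T" for p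
    using that disj rigidD(2)[OF rigid_S] rigidD(3)[OF rigid_S] by (rule well_ended_join_left)
  have right: "well_ended ?L ?Q p"
    if "well_ended (star_labeling S v) {(S, k)} p" "p \<noteq> []" "set p \<subseteq> pverts S" for p
    using that disj rigidD(2)[OF rigid_T] rigidD(2)[OF rigid_S] rigidD(3)[OF rigid_T] by (rule well_ended_join_right)
  have "path_lengths C = M + ?MS \<and> (\<forall>p\<in>C. well_ended ?L ?Q p)"
    if C: "min_path_covering J C" for C
    using S.path_covering_spider_center_end(1) C
  proof (rule min_path_covering_join)
    fix CT CS
    assume CT: "min_path_covering T CT" and CS: "min_path_covering S CS"
      and C: "C = CT \<union> CS" "CT \<inter> CS = {}"
    have cov: "path_covering T CT" "path_covering S CS"
      using CT CS by (simp_all add: min_path_covering_def)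
    have "path_lengths C = M + ?MS"
      using path_lengths_Un[OF _ _ C(2)] M[OF CT] S.min_path_covering_spider(1)[OF CS] C(1)
        finite_path_covering[OF cov(1) finT] finite_path_covering[OF cov(2) finS]
      by simp
    moreover have "well_ended ?L ?Q p" if "p \<in> CT" for p
      using rigidD(4)[OF rigid_T CT that] path_covering_paths(1,3)[OF cov(1) that] by (rule left)
    moreover have "well_ended ?L ?Q p" if "p \<in> CS" for p
      using rigidD(4)[OF rigid_S CS that] path_covering_paths(1,3)[OF cov(2) that] by (rule right)
    ultimately show ?thesis using C(1) by blast
  next
    fix CT CS a b p
    assume CT: "min_path_covering T CT" and CS: "path_covering S CS"
      and card: "card CS = Suc (path_cover_number S)" and ab: "a \<in> CT" "b \<in> CS"
      and ends: "last a = u" "hd b = v" and p: "p = a @ b \<or> p = rev (a @ b)"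
        "p \<notin> CT - {a} \<union> (CS - {b})"
      and C: "C = insert p (CT - {a} \<union> (CS - {b}))" "CT \<inter> CS = {}"
    have covT: "path_covering T CT" using CT by (simp add: min_path_covering_def)
    note pa = path_covering_paths[OF covT ab(1)] and pb = path_covering_paths[OF CS ab(2)]
    have "v \<in> ends b" using ends by (simp add: ends_def)
    note star = S.path_covering_spider_center_end(2)[OF CS ab(2) this card]
    have wa: "well_ended L Q a" using rigidD(4)[OF rigid_T CT ab(1)] .
    have "u \<in> ends a" using ends by (simp add: ends_def)
    then have wu: "hd a \<noteq> last a" "\<forall>x\<in>set a. L x = Some Label_B \<longrightarrow> x = u"
      "\<forall>G k. (G, k) \<in> Q \<longrightarrow> u \<in> pverts G \<longrightarrow> length a = k"
      using wa label_u(1) by (simp_all add: well_ended_def)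
    have a: "hd a \<noteq> u" "length a = k"
      using wu(1) ends(1) wu(3)[rule_format, OF label_u(2,3)] by simp_all
    have fin: "finite (CT - {a})" "finite (CS - {b})" "finite CT" "finite CS"
      using finite_path_covering[OF covT finT] finite_path_covering[OF CS finS] by simp_all
    \<comment> \<open>\<open>a\<close> has \<open>k\<close> vertices by the invariant, and
      \<open>b\<close> has \<open>Suc k\<close>: a vine together with the center.\<close>
    have "length p = 2 * k + 1" using p(1) a(2) star by auto
    moreover have "path_lengths C =
        add_mset (length p) (path_lengths (CT - {a}) + path_lengths (CS - {b}))"
    proof -
      have "path_lengths (CT - {a} \<union> (CS - {b})) = path_lengths (CT - {a}) + path_lengths (CS - {b})"
        using fin C(2) by (intro path_lengths_Un) auto
      moreover have "path_lengths C = add_mset (length p) (path_lengths (CT - {a} \<union> (CS - {b})))"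
        using p(2) fin unfolding C(1) path_lengths_def by simp
      ultimately show ?thesis by simp
    qed
    moreover have "M = add_mset k (path_lengths (CT - {a}))"
      using path_lengths_remove[OF fin(3) ab(1)] M[OF CT] a(2) by simp
    moreover have "path_lengths (CS - {b}) = replicate_mset (card V - 1) k"
      using path_lengths_remove[OF fin(4) ab(2)] star by simp
    moreover have "card V - 1 = Suc (card V - 2)" using S.two_vines by simp
    ultimately have "path_lengths C = M + ?MS" by simp
    moreover have "well_ended ?L ?Q (a @ b)"
    proof (rule well_ended_unlabeled)
      fix w assume "w \<in> ends (a @ b)"
      then consider "w = hd a" | "w = last b" using pa(1) pb(1) by (auto simp: ends_def)
      then show "?L w = None"
      proof cases
        case 1
        then have w: "w \<in> set a" "w \<in> ends a" using pa(1) by (simp_all add: ends_def)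
        \<comment> \<open>\<open>u\<close> is the only vertex of \<open>a\<close> labeled B, and
          \<open>hd a\<close> is not \<open>u\<close>.\<close>
        then have "L w \<noteq> Some Label_A" "L w \<noteq> Some Label_B"
          using wa a(1) wu(2) 1 by (auto simp: well_ended_def)
        then have "L w = None" by (metis label.exhaust not_None_eq)
        moreover have "w \<notin> pverts S" using w(1) pa(3) disj by blast
        then have "star_labeling S v w = None" by (simp add: star_labeling_def)
        ultimately show ?thesis by (simp add: map_add_None)
      next
        case 2
        then have "w \<in> set b" "w \<in> ends b" using pb(1) by (simp_all add: ends_def)
        \<comment> \<open>\<open>b\<close> has more than one vertex, so its far end is not the
          center and is therefore unlabeled.\<close>
        moreover have "last b \<noteq> v"
        proof -
          obtain ys where ys: "b = v # ys" using ends(2) pb(1) by (cases b) simp_all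
          moreover have "ys \<noteq> []" using ys star S.k_pos by auto
          ultimately show ?thesis using pb(2) by (auto dest: last_in_set)
        qed
        moreover have "\<forall>w\<in>ends b. w = v \<or> star_labeling S v w = None" using star by simp
        ultimately have "star_labeling S v w = None" "w \<notin> pverts T"
          using 2 pb(3) disj by auto
        then show ?thesis using rigidD(2)[OF rigid_T] by (auto simp: map_add_None)
      qed
    qed
    then have "well_ended ?L ?Q p" using p(1) by (metis well_ended_rev)
    moreover have "well_ended ?L ?Q q" if "q \<in> CT - {a}" for q
      using left[OF rigidD(4)[OF rigid_T CT] path_covering_paths(1,3)[OF covT], of q] that by simp
    moreover have "well_ended ?L ?Q q" if "q \<in> CS - {b}" for q
      using right[OF _ path_covering_paths(1,3)[OF CS], of q] star that by simp
    ultimately show ?thesis unfolding C(1) by blast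
  qed
  moreover have "dom ?L \<subseteq> pverts J" using rigidD(2)[OF rigid_T] rigidD(2)[OF rigid_S] by auto
  moreover have "pverts H \<subseteq> pverts J" if "(H, l) \<in> ?Q" for H l
    using that rigidD(3)[OF rigid_T, of H l] by auto
  ultimately have "rigid J ?L ?Q" using pair_pseudo_graph_join unfolding rigid_def by blast
  then show ?thesis by simp
qed

lemma rigid_unique_path_sequence:
  assumes "rigid T L Q"
  shows "unique_path_sequence T"
proof -
  obtain M where "\<forall>C. min_path_covering T C \<longrightarrow> path_lengths C = M"
    using rigid_path_lengths[OF assms] .
  then show ?thesis
    by (simp add: unique_path_sequence_def path_sequence_def flip: path_lengths_def)
qed

section \<open>Path pieces\<close>

lemma leaf_path_graph:
  assumes "distinct p" "2 \<le> length p" "w \<in> ends p"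
  shows "leaf (path_graph p) w"
proof -
  have p: "p \<noteq> []" using assms(2) by auto
  have "\<exists>y. {z. adjacent (path_graph p) w z} = {y}"
  proof (cases "w = hd p")
    case True
    then have w: "w = p ! 0" using p by (simp add: hd_conv_nth)
    have "z = p ! Suc 0" if "adjacent (path_graph p) w z" for z
      using adjacent_path_graph_nth[OF assms(1), of 0 z] that p w by simp
    moreover have "adjacent (path_graph p) w (p ! Suc 0)"
      using assms(2) w unfolding parcs_path_graph by (intro exI[of _ 0]) simp
    ultimately show ?thesis by blast
  next
    case False
    define n where "n = length p - 2"
    have n: "length p = Suc (Suc n)" using assms(2) by (simp add: n_def)
    have w: "w = p ! Suc n" using False assms(3) p n by (simp add: ends_def last_conv_nth)
    have "z = p ! n" if "adjacent (path_graph p) w z" for z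
      using adjacent_path_graph_nth[OF assms(1), of "Suc n" z] that n w by auto
    moreover have "adjacent (path_graph p) w (p ! n)"
      using n w unfolding parcs_path_graph by (intro exI[of _ n]) simp
    ultimately show ?thesis by blast
  qed
  moreover have "w \<in> set p" using assms(3) p by (auto simp: ends_def)
  ultimately show ?thesis by (auto simp: leaf_iff)
qed

lemma path_cover_number_path_graph:
  assumes "distinct p" "p \<noteq> []"
  shows "path_cover_number (path_graph p) = 1"
proof (rule antisym)
  have "path_covering (path_graph p) {p}"
    using vpath_path_graph[OF assms] by (intro path_coveringI) auto
  then show "path_cover_number (path_graph p) \<le> 1" using path_cover_number_le by fastforce
  obtain C where C: "min_path_covering (path_graph p) C" using ex_min_path_covering by blast
  then have cov: "path_covering (path_graph p) C" by (simp add: min_path_covering_def)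
  have "C \<noteq> {}" using path_coveringD(3)[OF cov] assms(2) by auto
  then have "0 < card C" using finite_path_covering[OF cov] by (simp add: card_gt_0_iff)
  then show "1 \<le> path_cover_number (path_graph p)" using C by (simp add: min_path_covering_def)
qed

lemma single_path_covering_path_graph:
  assumes p: "distinct p" and C: "path_covering (path_graph p) C" "card C = 1"
  shows "C = {p} \<or> C = {rev p}"
proof -
  obtain q where q: "C = {q}" using C(2) by (rule card_1_singletonE)
  have "vpath q (with_proj (path_graph p))" using path_coveringD(1)[OF C(1), of q] q by simp
  moreover have "set q = set p" using path_coveringD(3)[OF C(1)] q by simp
  ultimately have "q = p \<or> q = rev p" using vpath_path_graph_spanning[OF p] by simp
  then show ?thesis using q by blast
qed

text \<open>A minimum covering is the path itself in one of its two directions, and it ends in two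
  unlabeled leaves. A covering with a path ending in a non-leaf thus has more than one path.\<close>

lemma rigid_path_piece:
  assumes "path_piece P"
  shows "rigid P (path_labeling P) {}"
    and "path_covering P C \<Longrightarrow> q \<in> C \<Longrightarrow> v \<in> ends q \<Longrightarrow> \<not> leaf P v \<Longrightarrow>
      path_cover_number P < card C"
proof -
  obtain p where p: "distinct p" "3 \<le> length p" "P = path_graph p"
    using assms unfolding path_piece_def by blast
  then have ne: "p \<noteq> []" by auto
  have leaf: "leaf P w" if "w \<in> ends p" for w
    using leaf_path_graph[OF p(1) _ that] p by simp
  have num: "path_cover_number P = 1" using path_cover_number_path_graph[OF p(1) ne] p(3) by simp
  have single: "C = {p} \<or> C = {rev p}" if "path_covering P C" "card C = 1" for C
    using single_path_covering_path_graph[OF p(1)] that p(3) by simp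
  have "well_ended (path_labeling P) {} p"
    using leaf by (intro well_ended_unlabeled) (simp add: path_labeling_def)
  then have "path_lengths C = {#length p#} \<and> (\<forall>q\<in>C. well_ended (path_labeling P) {} q)"
    if "min_path_covering P C" for C
    using single[of C] that num by (auto simp: min_path_covering_def path_lengths_def)
  then show "rigid P (path_labeling P) {}"
    using pair_pseudo_graph_path_graph[of p] dom_path_labeling[of P] p(3)
    unfolding rigid_def by auto
  show "path_cover_number P < card C"
    if C: "path_covering P C" "q \<in> C" "v \<in> ends q" "\<not> leaf P v" for C q v
  proof (rule ccontr)
    assume "\<not> path_cover_number P < card C"
    then have "card C = 1" using path_cover_number_le[OF C(1)] num by simp
    then have "ends q = ends p" using single[OF C(1)] C(2) by auto
    then show False using leaf C(3,4) by simp
  qed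
qed

section \<open>Generalized stars are spiders\<close>

lemma path_graph_append:
  "xs \<noteq> [] \<Longrightarrow> ys \<noteq> [] \<Longrightarrow> parcs (path_graph (xs @ ys)) =
     parcs (path_graph xs) \<union> parcs (path_graph ys) \<union> {(last xs, hd ys), (hd ys, last xs)}"
  by (auto simp: path_graph_def vwalk_arcs_append)

lemma path_graph_rev: "parcs (path_graph (rev p)) = parcs (path_graph p)"
  by (auto simp: path_graph_def set_vwalk_arcs_rev)

text \<open>The half before the center is reversed so that both vines start next to
  \<open>c\<close>. As disjoint nonempty lists they differ, so the set of vines really has two
  elements.\<close>

lemma two_vine_star_spider:
  assumes "two_vine_star S c k"
  obtains V where "spider S c k V"
proof -
  obtain p where p: "1 \<le> k" "distinct p" "length p = 2 * k + 1" "S = path_graph p" "c = p ! k"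
    using assms unfolding two_vine_star_def by blast
  define xs where "xs = take k p"
  define ys where "ys = drop (Suc k) p"
  have split: "p = xs @ c # ys" using id_take_nth_drop[of k p] p by (simp add: xs_def ys_def)
  have len: "length xs = k" "length ys = k" using p by (simp_all add: xs_def ys_def)
  then have ne: "xs \<noteq> []" "ys \<noteq> []" using p(1) by auto
  have dis: "distinct (xs @ c # ys)" using p(2) split by simp
  have "rev xs \<noteq> ys" using dis ne by (auto simp flip: set_empty)
  have "parcs S = parcs (path_graph xs) \<union> parcs (path_graph ys) \<union>
      {(c, hd ys), (hd ys, c), (c, last xs), (last xs, c)}"
    using path_graph_append[OF ne(1), of "c # ys"] path_graph_append[of "[c]" ys] ne(2)
    unfolding p(4) split by (auto simp: path_graph_def[of "[c]"])
  then have "parcs S = (\<Union>q\<in>{rev xs, ys}. {(c, hd q), (hd q, c)} \<union> parcs (path_graph q))"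
    using ne by (auto simp: path_graph_rev hd_rev)
  then have "spider S c k {rev xs, ys}"
    using dis len p(1) \<open>rev xs \<noteq> ys\<close>
    by unfold_locales (auto simp: p(4) split)
  then show ?thesis by (rule that)
qed

section \<open>Decomposition of a generalized star into branches at its center\<close>

context
  fixes S :: "'a pair_pre_digraph" and c :: 'a and k :: nat
  assumes star: "generalized_star S c k"
begin

lemma star_facts:
  shows "pair_pseudo_graph S" "adjacent S x y \<Longrightarrow> adjacent S y x" "\<not> adjacent S x x"
    "adjacent S x y \<Longrightarrow> x \<in> pverts S \<and> y \<in> pverts S" "finite {w. adjacent S v w}"
    "\<not> undirected_cycle S p" "c \<in> pverts S" "2 < card {w. adjacent S c w}"
    "v \<noteq> c \<Longrightarrow> card {w. adjacent S v w} \<le> 2 \<or> v \<notin> pverts S"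
    "v \<in> pverts S \<Longrightarrow> light S v \<longleftrightarrow> v \<noteq> c"
    "vine S p \<Longrightarrow> length p = k"
proof -
  have tree: "undirected_tree S" and heavy: "{v. heavy S v} = {c}"
    and vines: "\<And>p. vine S p \<Longrightarrow> length p = k"
    using star by (simp_all add: generalized_star_def)
  interpret pair_graph S using tree by (simp add: undirected_tree_def)
  show ps: "pair_pseudo_graph S" by (rule pair_pseudo_graph_axioms)
  show "adjacent S x y \<Longrightarrow> adjacent S y x" using pair_pseudo_graphD(3)[OF ps] .
  show "\<not> adjacent S x x" using pair_no_loops[of "(x, x)"] by auto
  show "adjacent S x y \<Longrightarrow> x \<in> pverts S \<and> y \<in> pverts S" using pair_pseudo_graphD(2)[OF ps] by auto
  have "{w. adjacent S v w} \<subseteq> pverts S" using pair_pseudo_graphD(2)[OF ps] by auto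
  then show "finite {w. adjacent S v w}" using pair_pseudo_graphD(1)[OF ps] finite_subset by metis
  show "\<not> undirected_cycle S p" using tree by (simp add: undirected_tree_def)
  have "heavy S c" using heavy by blast
  then show "c \<in> pverts S" "2 < card {w. adjacent S c w}" by (simp_all add: heavy_iff)
  have nh: "\<not> heavy S v" if "v \<noteq> c" using heavy that by blast
  then show "v \<noteq> c \<Longrightarrow> card {w. adjacent S v w} \<le> 2 \<or> v \<notin> pverts S"
    by (auto simp: heavy_iff)
  show "v \<in> pverts S \<Longrightarrow> light S v \<longleftrightarrow> v \<noteq> c"
    using nh \<open>heavy S c\<close> by (auto simp: light_def)
  show "vine S p \<Longrightarrow> length p = k" by (rule vines)
qed

definition branch :: "'a list \<Rightarrow> bool" where
  "branch q \<longleftrightarrow> q \<noteq> [] \<and> vpath (c # q) (with_proj S)"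

lemma branchD:
  assumes "branch q"
  shows "q \<noteq> []" "c \<notin> set q" "distinct q" "set q \<subseteq> pverts S" "successively (adjacent S) (c # q)"
    "adjacent S c (hd q)" "successively (adjacent S) q"
  using assms by (auto simp: branch_def vpath_iff successively_Cons)

text \<open>Maximality is by length, so that existence follows from the bound by the number of
  vertices. Only branches through the same neighbor of \<open>c\<close> compete, which yields a vine
  for each neighbor.\<close>

definition maximal_branch :: "'a list \<Rightarrow> bool" where
  "maximal_branch q \<longleftrightarrow> branch q \<and> (\<forall>r. branch r \<and> hd r = hd q \<longrightarrow> length r \<le> length q)"

lemma ex_maximal_branch:
  assumes "adjacent S c x"
  shows "\<exists>q. maximal_branch q \<and> hd q = x"
proof -
  have "x \<noteq> c" using assms star_facts(3) by blast
  then have "branch [x]" using assms star_facts(4)[OF assms] by (simp add: branch_def vpath_iff)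
  moreover have "length r < Suc (card (pverts S))" if "branch r" for r
  proof -
    have "length r = card (set r)" using branchD(3)[OF that] by (simp add: distinct_card)
    also have "\<dots> \<le> card (pverts S)"
      using branchD(4)[OF that] pair_pseudo_graphD(1)[OF star_facts(1)] by (rule card_mono[rotated])
    finally show ?thesis by simp
  qed
  ultimately obtain q where "branch q \<and> hd q = x"
      "\<forall>r. branch r \<and> hd r = x \<longrightarrow> length r \<le> length q"
    using ex_has_greatest_nat[of "\<lambda>r. branch r \<and> hd r = x" "[x]" length "Suc (card (pverts S))"]
    by auto
  then show ?thesis by (intro exI[of _ q]) (simp add: maximal_branch_def)
qed

text \<open>A further neighbor of the last vertex would close a cycle or extend the branch.\<close>

lemma last_neighbor:
  assumes q: "maximal_branch q" and adj: "adjacent S (last q) w"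
  shows "w = (c # q) ! (length q - 1)"
proof (rule ccontr)
  assume neq: "w \<noteq> (c # q) ! (length q - 1)"
  have b: "branch q" using q by (simp add: maximal_branch_def)
  note bD = branchD[OF b]
  show False
  proof (cases "w \<in> set (c # q)")
    case True
    then obtain j where j: "j < length (c # q)" "w = (c # q) ! j" by (metis in_set_conv_nth)
    have last: "last q = (c # q) ! length q" using bD(1) by (simp add: last_conv_nth nth_Cons')
    have "j \<noteq> length q" using adj j(2) last star_facts(3) by auto
    moreover have "j \<noteq> length q - 1" using neq j(2) by auto
    ultimately have j': "Suc (Suc j) \<le> length q" using j(1) by simp
    \<comment> \<open>The segment from \<open>w\<close> to \<open>last q\<close> closes up through
      \<open>adj\<close>. It has at least three vertices because \<open>w\<close> is neither
      \<open>last q\<close> nor its predecessor.\<close>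
    let ?p = "drop j (c # q)"
    have pw: "c # q = take j (c # q) @ ?p" by simp
    have ne: "?p \<noteq> []" using j(1) by simp
    have "successively (adjacent S) ?p"
      using bD(5) by (subst (asm) pw) (simp only: successively_append_iff)
    moreover have "distinct ?p" using bD(2,3) by (intro distinct_drop) simp
    moreover have "set ?p \<subseteq> pverts S"
      using set_drop_subset[of j "c # q"] bD(4) star_facts(7) by auto
    ultimately have "vpath ?p (with_proj S)" using ne by (simp add: vpath_iff)
    moreover have "hd ?p = w" using j by (simp add: hd_drop_conv_nth)
    moreover have "last ?p = last q" using j(1) bD(1) by (simp add: last_drop del: drop_Cons')
    moreover have "3 \<le> length ?p" using j' by simp
    ultimately have "undirected_cycle S ?p" using adj by (simp add: undirected_cycle_def)
    then show False using star_facts(6) by blast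
  next
    case False
    have "branch (q @ [w])"
      using bD False adj star_facts(4)[OF adj] star_facts(7)
      by (auto simp: branch_def vpath_iff successively_append_iff successively_Cons)
    moreover have "hd (q @ [w]) = hd q" using bD(1) by simp
    ultimately show False using q unfolding maximal_branch_def by fastforce
  qed
qed

text \<open>\<open>(c # q) ! i\<close> is the predecessor of \<open>q ! i\<close>, with
  \<open>c\<close> preceding \<open>q ! 0\<close>. A vertex before the last is light, so its
  predecessor and successor exhaust its neighbors; \<open>last_neighbor\<close> treats the last
  one.\<close>

lemma branch_neighbor:
  assumes q: "maximal_branch q" and i: "i < length q" and adj: "adjacent S (q ! i) w"
  shows "w = (c # q) ! i \<or> Suc i < length q \<and> w = q ! Suc i"
proof (cases "Suc i < length q")
  case False
  then have "i = length q - 1" using i by simp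
  moreover have "q \<noteq> []" using i by auto
  with calculation have "last q = q ! i" by (simp add: last_conv_nth)
  ultimately show ?thesis using last_neighbor[OF q, of w] adj by simp
next
  case True
  have b: "branch q" using q by (simp add: maximal_branch_def)
  note bD = branchD[OF b]
  have a1: "adjacent S (q ! i) ((c # q) ! i)"
    using successively_nth[OF bD(5), of i] i star_facts(2) by simp
  have a2: "adjacent S (q ! i) (q ! Suc i)" using successively_nth[OF bD(7) True] .
  have "distinct (c # q)" using bD by simp
  then have "(c # q) ! i \<noteq> (c # q) ! Suc (Suc i)"
    using True by (subst nth_eq_iff_index_eq) simp_all
  then have c2: "card {(c # q) ! i, q ! Suc i} = 2" by simp
  have "q ! i \<in> set q" using i by simp
  then have "q ! i \<noteq> c" "q ! i \<in> pverts S" using bD by auto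
  then have "card {w. adjacent S (q ! i) w} \<le> 2" using star_facts(9) by blast
  moreover have "{(c # q) ! i, q ! Suc i} \<subseteq> {w. adjacent S (q ! i) w}" using a1 a2 by simp
  ultimately have "{(c # q) ! i, q ! Suc i} = {w. adjacent S (q ! i) w}"
    using card_seteq[OF star_facts(5)] c2 by metis
  then have "w \<in> {(c # q) ! i, q ! Suc i}" using adj by blast
  then show ?thesis using True by simp
qed

text \<open>Its last vertex is a leaf. A longer light path would have to add a neighbor of
  \<open>q\<close> outside \<open>q\<close>, but the only such neighbor is \<open>c\<close>, which
  is heavy. Hence the length condition of the star applies to \<open>q\<close>.\<close>

lemma vine_maximal_branch:
  assumes q: "maximal_branch q"
  shows "vine S q"
proof -
  have b: "branch q" using q by (simp add: maximal_branch_def)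
  note bD = branchD[OF b]
  have vp: "vpath q (with_proj S)" using bD by (simp add: vpath_iff)
  have last: "last q = q ! (length q - 1)" "length q - 1 < length q" "Suc (length q - 1) = length q"
    using bD(1) by (simp_all add: last_conv_nth)
  have "adjacent S (last q) ((c # q) ! (length q - 1))"
    using successively_nth[OF bD(5), of "length q - 1"] last star_facts(2) by simp
  then have "{w. adjacent S (last q) w} = {(c # q) ! (length q - 1)}"
    using last_neighbor[OF q] by blast
  then have "leaf S (last q)" using bD(1,4) by (auto simp: leaf_iff)
  moreover have "light S v" if "v \<in> set q" for v
    using that bD(2,4) star_facts(10) by blast
  ultimately have "light_leaf_path S q" using vp by (simp add: light_leaf_path_def)
  moreover have "r = q" if r: "light_leaf_path S r" "sublist q r" for r
  proof -
    obtain xs ys where r_eq: "r = xs @ q @ ys" using r(2) by (auto simp: sublist_def)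
    have vr: "distinct r" "successively (adjacent S) r" "set r \<subseteq> pverts S"
      using r(1) by (simp_all add: light_leaf_path_def vpath_iff)
    have nc: "c \<notin> set r" using r(1) star_facts(7,10) by (auto simp: light_leaf_path_def)
    have not_nbr: "w \<in> set q \<or> w = c" if v: "v \<in> set q" "adjacent S v w" for v w
    proof -
      obtain i where i: "i < length q" "v = q ! i" using v(1) by (metis in_set_conv_nth)
      then consider "w = (c # q) ! i" | "Suc i < length q" "w = q ! Suc i"
        using branch_neighbor[OF q i(1), of w] v(2) by auto
      then show ?thesis
      proof cases
        case 1
        moreover have "(c # q) ! i \<in> set (c # q)" using i(1) by (intro nth_mem) simp
        ultimately show ?thesis by auto
      qed simp
    qed
    have "ys = []"
    proof (rule ccontr)
      assume ys: "ys \<noteq> []"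
      have "adjacent S (last q) (hd ys)"
        using vr(2) bD(1) ys unfolding r_eq by (simp add: successively_append_iff)
      then have "hd ys \<in> set q \<or> hd ys = c" by (rule not_nbr[rotated]) (use bD(1) in simp)
      moreover have "hd ys \<in> set ys" using ys by simp
      ultimately show False using vr(1) nc unfolding r_eq by auto
    qed
    moreover have "xs = []"
    proof (rule ccontr)
      assume xs: "xs \<noteq> []"
      have "adjacent S (last xs) (hd q)"
        using vr(2) bD(1) xs unfolding r_eq by (simp add: successively_append_iff)
      then have "adjacent S (hd q) (last xs)" by (rule star_facts(2))
      then have "last xs \<in> set q \<or> last xs = c" by (rule not_nbr[rotated]) (use bD(1) in simp)
      moreover have "last xs \<in> set xs" using xs by simp
      ultimately show False using vr(1) nc unfolding r_eq by auto
    qed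
    ultimately show ?thesis using r_eq by simp
  qed
  ultimately show ?thesis unfolding vine_def by blast
qed

text \<open>Go back along \<open>r\<close> from the common vertex to the center. Neighbors of
  vertices of \<open>q\<close> other than \<open>c\<close> lie in \<open>q\<close>, so
  \<open>q\<close> is not left before \<open>hd r\<close> is reached.\<close>

lemma maximal_branches_disjoint:
  assumes q: "maximal_branch q" and r: "maximal_branch r" and i: "i < length r" "r ! i \<in> set q"
  shows "hd q = hd r"
proof -
  have bq: "branch q" and br: "branch r" using q r by (simp_all add: maximal_branch_def)
  note qD = branchD[OF bq] and rD = branchD[OF br]
  show ?thesis using i
  proof (induction i)
    case 0
    obtain j where j: "j < length q" "r ! 0 = q ! j" using 0 by (metis in_set_conv_nth)
    have "adjacent S (q ! j) c" using rD(6,1) star_facts(2) j(2) by (simp add: hd_conv_nth)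
    then have "c = (c # q) ! j \<or> Suc j < length q \<and> c = q ! Suc j"
      by (rule branch_neighbor[OF q j(1)])
    \<comment> \<open>\<open>c\<close> does not occur in \<open>q\<close>, so it is the predecessor
      of \<open>q ! j\<close> only at the head.\<close>
    then have "j = 0" using qD(2) j(1) nth_mem[of "j - 1" q] nth_mem[of "Suc j" q]
      by (auto simp: nth_Cons' split: if_splits)
    then show ?case using j qD(1) rD(1) by (simp add: hd_conv_nth)
  next
    case (Suc i)
    obtain j where j: "j < length q" "r ! Suc i = q ! j" using Suc.prems(2) by (metis in_set_conv_nth)
    have "adjacent S (q ! j) (r ! i)"
      using successively_nth[OF rD(7) Suc.prems(1)] star_facts(2) j(2) by simp
    then have "r ! i = (c # q) ! j \<or> Suc j < length q \<and> r ! i = q ! Suc j"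
      by (rule branch_neighbor[OF q j(1)])
    moreover have "(c # q) ! j \<in> set (c # q)" using j(1) by (intro nth_mem) simp
    moreover have "r ! i \<noteq> c" using rD(2) Suc.prems(1) nth_mem[of i r] by auto
    ultimately have "r ! i \<in> set q" by auto
    then show ?case using Suc.IH Suc.prems(1) by simp
  qed
qed

text \<open>One longest branch is chosen for each neighbor of the center, so the number of vines is
  the degree of \<open>c\<close>. What remains is that these branches exhaust the vertices and arcs
  of \<open>S\<close>.\<close>

lemma generalized_star_spider: "\<exists>V. spider S c k V"
proof -
  let ?N = "{x. adjacent S c x}"
  obtain Q where Q: "\<And>x. adjacent S c x \<Longrightarrow> maximal_branch (Q x) \<and> hd (Q x) = x"
    using ex_maximal_branch by metis
  define V where "V = Q ` ?N"
  have V: "maximal_branch q" "branch q" if "q \<in> V" for q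
    using that Q by (auto simp: V_def maximal_branch_def)
  have hd_inj: "q = r" if "q \<in> V" "r \<in> V" "hd q = hd r" for q r
    using that Q by (auto simp: V_def)
  have "inj_on Q ?N" using Q by (intro inj_on_inverseI[of _ hd]) simp
  then have "card V = card ?N" by (simp add: V_def card_image)
  then have card_V: "2 < card V" using star_facts(8) by simp
  have len: "length q = k" if "q \<in> V" for q
    using star_facts(11)[OF vine_maximal_branch[OF V(1)[OF that]]] .
  have disj: "q = r" if "q \<in> V" "r \<in> V" "x \<in> set q" "x \<in> set r" for q r x
  proof -
    obtain i where "i < length r" "x = r ! i" using \<open>x \<in> set r\<close> by (metis in_set_conv_nth)
    then have "hd q = hd r"
      using maximal_branches_disjoint[OF V(1) V(1)] that by blast
    then show ?thesis using hd_inj that by blast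
  qed
  let ?X = "insert c (\<Union>q\<in>V. set q)"
  have arcs: "\<exists>q\<in>V. (x, y) \<in> {(c, hd q), (hd q, c)} \<union> parcs (path_graph q)"
    if x: "x \<in> ?X" and adj: "adjacent S x y" for x y
  proof (cases "x = c")
    case True
    then have "Q y \<in> V" "hd (Q y) = y" using Q adj by (auto simp: V_def)
    then show ?thesis using True by (intro bexI[of _ "Q y"]) simp_all
  next
    case False
    then obtain q where q: "q \<in> V" "x \<in> set q" using x by blast
    then obtain i where i: "i < length q" "x = q ! i" by (metis in_set_conv_nth)
    have ne: "q \<noteq> []" using i by auto
    have "y = (c # q) ! i \<or> Suc i < length q \<and> y = q ! Suc i"
      using branch_neighbor[OF V(1)[OF q(1)] i(1)] adj i(2) by simp
    then consider "i = 0" "y = c" | "0 < i" "y = q ! (i - 1)" | "Suc i < length q" "y = q ! Suc i"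
      by (auto simp: nth_Cons' split: if_splits)
    then have "(x, y) \<in> {(c, hd q), (hd q, c)} \<union> parcs (path_graph q)"
    proof cases
      case 1
      then show ?thesis using i ne by (simp add: hd_conv_nth)
    next
      case 2
      then have "\<exists>j. Suc j < length q \<and> (x = q ! j \<and> y = q ! Suc j \<or> y = q ! j \<and> x = q ! Suc j)"
        using i by (intro exI[of _ "i - 1"]) simp
      then show ?thesis unfolding parcs_path_graph[symmetric] by simp
    next
      case 3
      then have "\<exists>j. Suc j < length q \<and> (x = q ! j \<and> y = q ! Suc j \<or> y = q ! j \<and> x = q ! Suc j)"
        using i by (intro exI[of _ i]) simp
      then show ?thesis unfolding parcs_path_graph[symmetric] by simp
    qed
    then show ?thesis using q(1) by blast
  qed
  have sub: "?X \<subseteq> pverts S" using star_facts(7) branchD(4)[OF V(2)] by blast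
  have closed: "y \<in> ?X" if x: "x \<in> ?X" and adj: "adjacent S x y" for x y
  proof -
    obtain q where q: "q \<in> V" "(x, y) \<in> {(c, hd q), (hd q, c)} \<union> parcs (path_graph q)"
      using arcs[OF x adj] by blast
    have "hd q \<in> set q" using branchD(1)[OF V(2)[OF q(1)]] by simp
    moreover have "y \<in> set q" if "(x, y) \<in> parcs (path_graph q)"
      using pair_pseudo_graphD(2)[OF pair_pseudo_graph_path_graph, of q] that by auto
    ultimately show ?thesis using q by auto
  qed
  \<comment> \<open>The center and the branches are closed under adjacency and \<open>S\<close> is
    connected. Connectedness refers to the symmetric closure, in which reachability is the same
    because the arcs are already symmetric.\<close>
  have "pverts S \<subseteq> ?X"
  proof
    fix v assume v: "v \<in> pverts S"
    interpret pair_pseudo_graph S by (rule star_facts(1))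
    have "connected (with_proj S)" using star by (simp add: generalized_star_def undirected_tree_def)
    then have "c \<rightarrow>\<^sup>*\<^bsub>with_proj (mk_symmetric (with_proj S))\<^esub> v"
      using v star_facts(7) by (auto simp: connected_def strongly_connected_def)
    then have "c \<rightarrow>\<^sup>*\<^bsub>with_proj S\<^esub> v" using reachable_mk_symmetric_eq[OF pair_sym_arcs] by simp
    then show "v \<in> ?X"
    proof (induction rule: reachable_induct)
      case (step x y)
      then have "adjacent S x y" by simp
      then show ?case using closed[OF step(3)] by simp
    qed simp
  qed
  with sub have verts: "pverts S = ?X" by blast
  have "parcs S = (\<Union>q\<in>V. {(c, hd q), (hd q, c)} \<union> parcs (path_graph q))"
  proof
    show "parcs S \<subseteq> (\<Union>q\<in>V. {(c, hd q), (hd q, c)} \<union> parcs (path_graph q))"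
    proof
      fix e assume e: "e \<in> parcs S"
      obtain x y where xy: "e = (x, y)" by fastforce
      then have "x \<in> ?X" using star_facts(4)[of x y] e verts by simp
      then show "e \<in> (\<Union>q\<in>V. {(c, hd q), (hd q, c)} \<union> parcs (path_graph q))"
        using arcs e xy by simp
    qed
    show "(\<Union>q\<in>V. {(c, hd q), (hd q, c)} \<union> parcs (path_graph q)) \<subseteq> parcs S"
    proof (rule UN_least)
      fix q assume q: "q \<in> V"
      note bD = branchD[OF V(2)[OF q]]
      have "(x, y) \<in> parcs S" if xy: "(x, y) \<in> parcs (path_graph q)" for x y
      proof -
        obtain i where i: "Suc i < length q" "x = q ! i \<and> y = q ! Suc i \<or> y = q ! i \<and> x = q ! Suc i"
          using xy unfolding parcs_path_graph by blast
        then show ?thesis using successively_nth[OF bD(7) i(1)] star_facts(2) by blast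
      qed
      then have "parcs (path_graph q) \<subseteq> parcs S" by (intro subrelI)
      then show "{(c, hd q), (hd q, c)} \<union> parcs (path_graph q) \<subseteq> parcs S"
        using bD(6) star_facts(2)[OF bD(6)] by simp
    qed
  qed
  moreover obtain q where q: "q \<in> V" using card_V by fastforce
  have "0 < k" using len[OF q] branchD(1)[OF V(2)[OF q]] by auto
  ultimately have "spider S c k V"
    using card_V len disj verts branchD(2,3)[OF V(2)] star_facts(5)[of c]
    by (intro spider.intro) (simp_all add: V_def)
  then show ?thesis by blast
qed

end

section \<open>Induction over the construction\<close>

lemma constructible_rigid: "constructible T L Q \<Longrightarrow> rigid T L Q"
proof (induction rule: constructible.induct)
  case (init_star S c k)
  then obtain V where "spider S c k V" using generalized_star_spider by metis
  then show ?case by (rule spider.rigid_spider)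
next
  case (init_path P)
  then show ?case by (rule rigid_path_piece(1))
next
  case (type1 T L Q S v k u)
  then obtain V where "spider S v k V" using generalized_star_spider by metis
  then interpret spider S v k V .
  have "rigid (join_by_edge T S u v) (L ++ star_labeling S v) (Q \<union> {(S, k)})"
    using type1.IH rigid_spider type1.hyps(3,4,5) _ path_covering_spider_center_end(1)
    by (rule rigid_join) (simp add: pverts_eq)
  then show ?case by simp
next
  case (type2 T L Q P u v)
  have "rigid (join_by_edge T P u v) (L ++ path_labeling P) (Q \<union> {})"
    using type2.IH rigid_path_piece(1)[OF type2.hyps(2)] type2.hyps(3-6)
      rigid_path_piece(2)[OF type2.hyps(2) _ _ _ type2.hyps(7)]
    by (rule rigid_join)
  then show ?case by simp
next
  case (type3 T L Q S v k u S')
  then obtain V where "spider S v k V"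
    using generalized_star_spider two_vine_star_spider by metis
  with type3.IH show ?case using type3.hyps(3-7) by (rule rigid_join_spider)
qed

theorem theorem16:
  fixes T :: "'a pair_pre_digraph" and L :: "'a labeling"
  assumes "(T, L) \<in> family_F"
  shows "unique_path_sequence T"
  using assms constructible_rigid rigid_unique_path_sequence unfolding family_F_def by blast

end
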